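(* Let $(W,S)$ be a Coxeter system with $S$ finite and root system $\Phi$, and let $n\in\mathbb N$. The set $\Sigma_n$ of $n$-small roots is bipodal if and only if the following holds: for any pair of roots $\alpha,\beta\in\Phi^+$ such that $W':=\langle s_\alpha,s_\beta\rangle$ is a finite maximal dihedral reflection subgroup with canonical simple system $\Delta_{W'}=\{\alpha,\beta\}$, $B(\alpha,\beta)\neq 0$, and $s_\alpha(\beta)\in\Sigma_n$, one has $\alpha\in\Sigma_n$.
   Context: Here $\mathbb N=\{0,1,2,\dots\}$. Geometric representation and roots. Fix a geometric representation of $(W,S)$: a real vector space $V$ with a symmetric bilinear form $B$, and a simple system $\Delta=\{\alpha_s : s\in S\}\subseteq V$ (finite, indexed bijectively by $S$) such that: $\sum_{\alpha\in\Delta}a_\alpha\alpha=0$ with all $a_\alpha\ge 0$ implies all $a_\alpha=0$; $B(\alpha,\beta)\in\,]-\infty,-1]\cup\{-\cos(\pi/k): k\in\mathbb N, k\geq 2\}$ for distinct $\alpha,\beta\in\Delta$; $B(\alpha,\alpha)=1$ for $\alpha\in\Delta$; and $W$ is faithfully represented in the group of linear maps preserving $B$, with $s\in S$ acting by $v\mapsto v-2B(\alpha_s,v)\alpha_s$. (So $B(\alpha_s,\alpha_t)=-\cos(\pi/m_{st})$ if the order $m_{st}$ of $st$ is finite, and $B(\alpha_s,\alpha_t)\le -1$ iff $m_{st}=\infty$.) For $A\subseteq V$, $\operatorname{cone}(A)$ is the set of non-negative linear combinations of vectors of $A$. The root system is $\Phi=W(\Delta)$, with positive roots $\Phi^+=\operatorname{cone}(\Delta)\cap\Phi$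 and negative roots $\Phi^-=-\Phi^+$; $\Phi=\Phi^+\sqcup\Phi^-$. For $\beta\in\Phi$, $s_\beta\in W$ is the reflection $v\mapsto v-2B(\beta,v)\beta$. The (left) inversion set of $w\in W$ is $N(w)=\Phi^+\cap w(\Phi^-)$. $n$-small roots. For $\alpha,\beta\in\Phi^+$, write $\alpha\preceq\beta$ if for all $w\in W$, $\beta\in N(w)$ implies $\alpha\in N(w)$; write $\alpha\prec\beta$ if moreover $\alpha\neq\beta$. The $\infty$-depth of $\beta\in\Phi^+$ is $\operatorname{dp}_\infty(\beta)=|\{\alpha\in\Phi^+ : \alpha\prec\beta\}|$, and $\Sigma_n=\{\beta\in\Phi^+:\operatorname{dp}_\infty(\beta)\le n\}$. Reflection subgroups and bipodality. For a reflection subgroup $W'$ of $W$ (a subgroup generated by reflections $s_\beta$, $\beta\in\Phi$), put $\Phi_{W'}=\{\beta\in\Phi: s_\beta\in W'\}$, $\Phi_{W'}^+=\Phi_{W'}\cap\Phi^+$, and let $\Delta_{W'}=\{\alpha\in\Phi^+: N(s_\alpha)\cap\Phi_{W'}=\{\alpha\}\}$ be its canonical simple system. A maximal dihedral reflection subgroup is a subgroup $W'$ generated by $\{s_\beta:\beta\in P\cap\Phi\}$, where $P$ is a plane (2-dimensional linear subspace) of $V$ containing at least two positive roots; then $\Phi_{W'}=P\cap\Phi$ and $\Delta_{W'}=\{\alpha,\beta\}$ consists of two positive roots with $\Phi^+_{W'}=\operatorname{cone}(\alpha,\beta)\cap\Phi$. A subset $A\subseteq\Phi^+$ is bipodal if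 for every maximal dihedral reflection subgroup $W'$ of $W$: $A\cap(\Phi_{W'}^+\setminus\Delta_{W'})\neq\emptyset$ implies $\Delta_{W'}\subseteq A$. *)

theory Defs
  imports "HOL-Analysis.Analysis" "HOL-Algebra.Multiplicative_Group" "HOL-Algebra.Generated_Groups"
begin

section \<open>Coxeter systems\<close>

definition word_prod :: "('g, 'm) monoid_scheme \<Rightarrow> 'g list \<Rightarrow> 'g" where
  "word_prod W ws = foldr (\<lambda>s w. s \<otimes>\<^bsub>W\<^esub> w) ws \<one>\<^bsub>W\<^esub>"

text \<open>Insertion of one relator \<open>(s t)\<^sup>m\<close> into a word, where \<open>m\<close> is the order of \<open>s t\<close> in \<open>W\<close>.
  Note that \<^const>\<open>group.ord\<close> is \<open>0\<close> for elements of infinite order, in which case there is no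
  relator. For \<open>s = t\<close> an involution this is the relator \<open>s s\<close>.\<close>

inductive insert_relator :: "('g, 'm) monoid_scheme \<Rightarrow> 'g set \<Rightarrow> 'g list \<Rightarrow> 'g list \<Rightarrow> bool"
  for W S where
  "\<lbrakk> s \<in> S; t \<in> S; m = group.ord W (s \<otimes>\<^bsub>W\<^esub> t); m > 0 \<rbrakk> \<Longrightarrow>
     insert_relator W S (us @ vs) (us @ concat (replicate m [s, t]) @ vs)"

text \<open>\<open>W\<close> is presented by the generators \<open>S\<close> and the relations \<open>(s t)\<^sup>m = 1\<close>, \<open>m\<close> the order of \<open>s t\<close>. As the generators are
  involutions, it suffices to consider words without inverses; the last condition says that
  every relation between the generators is a consequence of these defining ones.\<close>

definition coxeter_system :: "('g, 'm) monoid_scheme \<Rightarrow> 'g set \<Rightarrow> bool" where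
  "coxeter_system W S \<longleftrightarrow>
     group W \<and> S \<subseteq> carrier W \<and> generate W S = carrier W \<and>
     (\<forall>s\<in>S. group.ord W s = 2) \<and>
     (\<forall>ws\<in>lists S. word_prod W ws = \<one>\<^bsub>W\<^esub> \<longrightarrow> equivclp (insert_relator W S) ws [])"

section \<open>Geometric representations\<close>

definition nonneg_cone :: "'v::real_vector set \<Rightarrow> 'v set" where
  "nonneg_cone A = {x. \<exists>F c. finite F \<and> F \<subseteq> A \<and> (\<forall>v\<in>F. 0 \<le> c v) \<and> x = (\<Sum>v\<in>F. c v *\<^sub>R v)}"

definition reflection :: "('v::real_vector \<Rightarrow> 'v \<Rightarrow> real) \<Rightarrow> 'v \<Rightarrow> 'v \<Rightarrow> 'v" where
  "reflection B \<beta> v = v - (2 * B \<beta> v) *\<^sub>R \<beta>"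

definition form_group :: "('v::real_vector \<Rightarrow> 'v \<Rightarrow> real) \<Rightarrow> ('v \<Rightarrow> 'v) monoid" where
  "form_group B =
     \<lparr> carrier = {f. linear f \<and> bij f \<and> (\<forall>x y. B (f x) (f y) = B x y)},
       monoid.mult = (\<lambda>f g. f \<circ> g), one = id \<rparr>"

text \<open>The data of a geometric representation: the pair \<open>(W, S)\<close>, the bilinear form \<open>B\<close> on the
  whole type \<open>'v\<close>, the map \<open>s \<mapsto> \<alpha>\<^sub>s\<close>, and the action of \<open>W\<close> on \<open>'v\<close>.\<close>

record ('g, 'v) rep_data =
  grp :: "'g monoid"
  gens :: "'g set"
  form :: "'v \<Rightarrow> 'v \<Rightarrow> real"
  simple_root :: "'g \<Rightarrow> 'v"
  act :: "'g \<Rightarrow> 'v \<Rightarrow> 'v"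

definition geometric_representation :: "('g, 'v::real_vector) rep_data \<Rightarrow> bool" where
  "geometric_representation R \<longleftrightarrow>
     coxeter_system (grp R) (gens R) \<and> finite (gens R) \<and>
     bilinear (form R) \<and> (\<forall>x y. form R x y = form R y x) \<and>
     inj_on (simple_root R) (gens R) \<and>
     (\<forall>c. (\<forall>s\<in>gens R. 0 \<le> c s) \<and> (\<Sum>s\<in>gens R. c s *\<^sub>R simple_root R s) = 0 \<longrightarrow>
        (\<forall>s\<in>gens R. c s = 0)) \<and>
     (\<forall>s\<in>gens R. \<forall>t\<in>gens R. s \<noteq> t \<longrightarrow>
        form R (simple_root R s) (simple_root R t) \<in> {..-1} \<union> {- cos (pi / real k) | k::nat. k \<ge> 2}) \<and>
     (\<forall>s\<in>gens R. form R (simple_root R s) (simple_root R s) = 1) \<and>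
     act R \<in> mon (grp R) (form_group (form R)) \<and>
     (\<forall>s\<in>gens R. act R s = reflection (form R) (simple_root R s))"

definition roots :: "('g, 'v::real_vector) rep_data \<Rightarrow> 'v set" where
  "roots R = {act R w (simple_root R s) | w s. w \<in> carrier (grp R) \<and> s \<in> gens R}"

definition pos_roots :: "('g, 'v::real_vector) rep_data \<Rightarrow> 'v set" where
  "pos_roots R = nonneg_cone (simple_root R ` gens R) \<inter> roots R"

definition neg_roots :: "('g, 'v::real_vector) rep_data \<Rightarrow> 'v set" where
  "neg_roots R = uminus ` pos_roots R"

text \<open>\<open>s\<^sub>\<beta>\<close> as an element of \<open>W\<close>: for a root \<open>\<beta>\<close>, the unique preimage of the linear reflection under
  the faithful action.\<close>

definition refl_elt :: "('g, 'v::real_vector) rep_data \<Rightarrow> 'v \<Rightarrow> 'g" where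
  "refl_elt R \<beta> = inv_into (carrier (grp R)) (act R) (reflection (form R) \<beta>)"

definition inversions :: "('g, 'v::real_vector) rep_data \<Rightarrow> 'g \<Rightarrow> 'v set" where
  "inversions R w = pos_roots R \<inter> act R w ` neg_roots R"

section \<open>Small roots\<close>

definition dominated :: "('g, 'v::real_vector) rep_data \<Rightarrow> 'v \<Rightarrow> 'v \<Rightarrow> bool" where
  "dominated R \<alpha> \<beta> \<longleftrightarrow>
     (\<forall>w\<in>carrier (grp R). \<beta> \<in> inversions R w \<longrightarrow> \<alpha> \<in> inversions R w)"

text \<open>The set counted here is contained in the inversion set of \<open>s\<^sub>\<beta>\<close>, which contains \<open>\<beta>\<close>; it is
  therefore finite, and \<^const>\<open>card\<close> is its true cardinality.\<close>

definition inf_depth :: "('g, 'v::real_vector) rep_data \<Rightarrow> 'v \<Rightarrow> nat" where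
  "inf_depth R \<beta> = card {\<alpha> \<in> pos_roots R. dominated R \<alpha> \<beta> \<and> \<alpha> \<noteq> \<beta>}"

definition small_roots :: "('g, 'v::real_vector) rep_data \<Rightarrow> nat \<Rightarrow> 'v set" where
  "small_roots R n = {\<beta> \<in> pos_roots R. inf_depth R \<beta> \<le> n}"

section \<open>Reflection subgroups and bipodality\<close>

definition sub_roots :: "('g, 'v::real_vector) rep_data \<Rightarrow> 'g set \<Rightarrow> 'v set" where
  "sub_roots R W' = {\<beta> \<in> roots R. refl_elt R \<beta> \<in> W'}"

definition sub_pos_roots :: "('g, 'v::real_vector) rep_data \<Rightarrow> 'g set \<Rightarrow> 'v set" where
  "sub_pos_roots R W' = sub_roots R W' \<inter> pos_roots R"

definition canonical_simples :: "('g, 'v::real_vector) rep_data \<Rightarrow> 'g set \<Rightarrow> 'v set" where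
  "canonical_simples R W' =
     {\<alpha> \<in> pos_roots R. inversions R (refl_elt R \<alpha>) \<inter> sub_roots R W' = {\<alpha>}}"

definition maximal_dihedral :: "('g, 'v::real_vector) rep_data \<Rightarrow> 'g set \<Rightarrow> bool" where
  "maximal_dihedral R W' \<longleftrightarrow>
     (\<exists>P. subspace P \<and> dim P = 2 \<and>
        (\<exists>\<beta>\<in>P \<inter> pos_roots R. \<exists>\<gamma>\<in>P \<inter> pos_roots R. \<beta> \<noteq> \<gamma>) \<and>
        W' = generate (grp R) (refl_elt R ` (P \<inter> roots R)))"

definition bipodal :: "('g, 'v::real_vector) rep_data \<Rightarrow> 'v set \<Rightarrow> bool" where
  "bipodal R A \<longleftrightarrow>
     A \<subseteq> pos_roots R \<and>
     (\<forall>W'. maximal_dihedral R W' \<longrightarrow>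
        A \<inter> (sub_pos_roots R W' - canonical_simples R W') \<noteq> {} \<longrightarrow>
        canonical_simples R W' \<subseteq> A)"

end

theory Submission
  imports Defs
begin

text \<open>
  A maximal dihedral reflection subgroup is the group of a plane \<open>P\<close> of roots. Its positive roots lie
  in the cone of two of them, \<open>x\<close> and \<open>y\<close>, which form the canonical simple system. So bipodality of
  \<open>\<Sigma>\<^sub>n\<close> says: if a positive root of \<open>P\<close> other than \<open>x\<close> and \<open>y\<close> is \<open>n\<close>-small, then so are \<open>x\<close> and \<open>y\<close>.
  The condition of the theorem is a special case, because \<open>s\<^sub>x y\<close> is such a root when \<open>B x y \<noteq> 0\<close>.

  For the converse, the key fact is \<open>depth_le_depth_rfl\<close>: if \<open>x\<close> and \<open>y\<close> are positive roots with
  \<open>B x y \<le> 0\<close>, then the \<open>\<infinity>\<close>-depth of \<open>y\<close> is at most that of \<open>s\<^sub>x y\<close>. A simple reflection \<open>s\<^sub>t\<close> maps the roots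
  dominated by a root \<open>y\<close> to those dominated by \<open>s\<^sub>t y\<close>, up to the simple root \<open>a t\<close> itself, which is
  dominated by \<open>y \<noteq> a t\<close> if and only if \<open>B (a t) y \<ge> 1\<close>. So the depth grows by one if \<open>B (a t) y \<le> -1\<close>, drops by one if
  \<open>B (a t) y \<ge> 1\<close>, and is constant otherwise. Summing along a word for \<open>f\<close> gives a formula for
  the change of depth from \<open>y\<close> to \<open>f y\<close>, as a sum over the inversions \<open>z\<close> of \<open>f\<close> of an odd, antitone function of
  \<open>B z y\<close> (\<open>signed_depth_image\<close>). For \<open>f = s\<^sub>x\<close> the involution \<open>z \<mapsto> - s\<^sub>x z\<close> of the inversions shows that the sum is nonnegative.

  Now let \<open>z\<close> be an \<open>n\<close>-small root of \<open>P\<close>, not simple. Reflecting repeatedly in a simple root of \<open>P\<close> that has a positive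
  product with the current root does not increase the depth, and it ends at \<open>x\<close> or \<open>y\<close>. Hence one of
  \<open>s\<^sub>x y\<close> and \<open>s\<^sub>y x\<close> is \<open>n\<close>-small (\<open>descent_small\<close>), and \<open>B x y < 0\<close>. Say it is \<open>s\<^sub>x y\<close>. Then \<open>y\<close> is \<open>n\<close>-small by the key fact. If
  \<open>B x y \<le> -1\<close>, then \<open>x\<close> is dominated by \<open>s\<^sub>x y\<close> (\<open>basis_dominated_by\<close>), hence \<open>n\<close>-small. If \<open>B x y > -1\<close>, then \<open>B x y\<close> is
  \<open>- cos (\<pi> / m)\<close> for some \<open>m\<close> (\<open>basis_angle\<close>), the dihedral group is finite, and \<open>x\<close> is \<open>n\<close>-small by the hypothesis of
  the theorem.

  The foundations are those of the theory of root systems: each root is positive or negative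
  (\<open>Phi_pos_or_neg\<close>), inversion sets are finite, dominance is governed by the form
  (\<open>dominated_by_imp_form_ge_1\<close>, \<open>form_ge_1_imp_dominated_by\<close>), and each plane with two positive roots has a simple system
  (\<open>dihedral_basis_exists\<close>). All of this concerns the group of linear maps generated by the simple
  reflections; the Coxeter group enters at the end through its faithful action.
\<close>

section \<open>Chebyshev numbers\<close>

text \<open>The numbers \<open>U\<^bsub>k-1\<^esub>(c)\<close>, \<open>U\<close> the Chebyshev polynomials of the second kind. They are the coefficients
  of the roots of a dihedral group whose simple roots \<open>a\<close>, \<open>b\<close> satisfy \<open>B a b = - c\<close>.\<close>
fun cheb :: "real \<Rightarrow> nat \<Rightarrow> real" where
  "cheb c 0 = 0"
| "cheb c (Suc 0) = 1"
| "cheb c (Suc (Suc k)) = 2 * c * cheb c (Suc k) - cheb c k"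

lemma sin_mult_cheb_cos: "sin t * cheb (cos t) k = sin (real k * t)"
proof (induction "cos t" k rule: cheb.induct)
  case (3 k)
  have "sin (real (Suc (Suc k)) * t) + sin (real k * t) = 2 * cos t * sin (real (Suc k) * t)"
    using sin_plus_sin[of "real (Suc (Suc k)) * t" "real k * t"]
    by (simp add: algebra_simps add_divide_distrib)
  moreover have "sin t * cheb (cos t) (Suc (Suc k))
      = 2 * cos t * (sin t * cheb (cos t) (Suc k)) - sin t * cheb (cos t) k"
    by (simp add: algebra_simps)
  ultimately show ?case using 3 by simp
qed auto

lemma cheb_strict_mono:
  assumes "1 \<le> c"
  shows "0 \<le> cheb c k \<and> cheb c k < cheb c (Suc k)"
proof (induction k)
  case (Suc k)
  have "1 * cheb c (Suc k) \<le> c * cheb c (Suc k)"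
    using Suc assms by (intro mult_right_mono) linarith+
  then have "2 * cheb c (Suc k) \<le> 2 * c * cheb c (Suc k)" by linarith
  then show ?case using Suc by (simp only: cheb.simps) linarith
qed simp

lemma cheb_cos_pos:
  assumes "0 < t" "0 < k" "real k * t < pi"
  shows "0 < cheb (cos t) k"
proof -
  have "t \<le> real k * t" using assms by (simp add: mult_le_cancel_right1)
  then have "0 < sin t" using assms by (intro sin_gt_zero) linarith+
  moreover have "0 < sin (real k * t)" using assms by (intro sin_gt_zero) auto
  ultimately show ?thesis using sin_mult_cheb_cos[of t k] by (metis zero_less_mult_pos)
qed

section \<open>Reflections and their dihedral groups\<close>

locale sym_form =
  fixes B :: "'v::real_vector \<Rightarrow> 'v \<Rightarrow> real"
  assumes bilin: "bilinear B" and sym: "B x y = B y x"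
begin

lemmas form_simps = bilinear_ladd[OF bilin] bilinear_radd[OF bilin] bilinear_lmul[OF bilin]
  bilinear_rmul[OF bilin] bilinear_lneg[OF bilin] bilinear_rneg[OF bilin]
  bilinear_lsub[OF bilin] bilinear_rsub[OF bilin] bilinear_lzero[OF bilin] bilinear_rzero[OF bilin]

abbreviation rfl :: "'v \<Rightarrow> 'v \<Rightarrow> 'v" where "rfl \<equiv> reflection B"

lemma rfl_eq: "rfl b v = v - (2 * B b v) *\<^sub>R b"
  by (simp add: reflection_def)

lemma linear_rfl: "linear (rfl b)"
  by (rule linearI) (simp_all add: rfl_eq form_simps algebra_simps)

lemma rfl_self: "B b b = 1 \<Longrightarrow> rfl b b = - b"
  by (simp add: rfl_eq algebra_simps scaleR_2)

lemma rfl_rfl: "B b b = 1 \<Longrightarrow> rfl b (rfl b v) = v"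
  by (simp add: rfl_eq form_simps algebra_simps)

lemma rfl_involution: "B b b = 1 \<Longrightarrow> rfl b \<circ> rfl b = id"
  by (simp add: fun_eq_iff rfl_rfl)

lemma form_rfl: "B b b = 1 \<Longrightarrow> B (rfl b x) (rfl b y) = B x y"
  by (simp add: rfl_eq form_simps algebra_simps sym[of x b])

lemma rfl_uminus: "rfl (- b) = rfl b"
  by (simp add: fun_eq_iff rfl_eq form_simps)

lemma isometry_rfl:
  assumes "linear f" "\<And>x y. B (f x) (f y) = B x y"
  shows "f (rfl b v) = rfl (f b) (f v)"
  using assms by (simp add: rfl_eq linear_diff linear_scale)

lemma rfl_fst_pair:
  assumes "B a a = 1"
  shows "rfl a (x *\<^sub>R a + y *\<^sub>R b) = (2 * (- B a b) * y - x) *\<^sub>R a + y *\<^sub>R b"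
  using assms by (simp add: rfl_eq form_simps algebra_simps) (simp flip: scaleR_left_distrib)

lemma rfl_snd_pair:
  assumes "B b b = 1"
  shows "rfl b (x *\<^sub>R a + y *\<^sub>R b) = x *\<^sub>R a + (2 * (- B a b) * x - y) *\<^sub>R b"
  using rfl_fst_pair[OF assms, of y x a] by (simp add: add.commute sym[of b a])

text \<open>Reflecting \<open>x a + y b\<close> alternately in \<open>b\<close> and \<open>a\<close> replaces one coefficient at a time by the
  next term of the Chebyshev recurrence.\<close>
lemma rotation_power:
  assumes "B a a = 1" "B b b = 1"
  shows "((rfl a \<circ> rfl b) ^^ k) a = cheb (- B a b) (Suc (2 * k)) *\<^sub>R a + cheb (- B a b) (2 * k) *\<^sub>R b"
proof (induction k)
  case (Suc k)
  have "((rfl a \<circ> rfl b) ^^ Suc k) a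
    = rfl a (rfl b (cheb (- B a b) (Suc (2 * k)) *\<^sub>R a + cheb (- B a b) (2 * k) *\<^sub>R b))"
    by (simp only: funpow.simps comp_apply Suc)
  also have "\<dots> = cheb (- B a b) (Suc (2 * Suc k)) *\<^sub>R a + cheb (- B a b) (2 * Suc k) *\<^sub>R b"
    unfolding rfl_snd_pair[OF assms(2)] rfl_fst_pair[OF assms(1)] by simp
  finally show ?case .
qed simp

lemma rotation_power_snd:
  assumes "B a a = 1" "B b b = 1"
  shows "((rfl a \<circ> rfl b) ^^ Suc k) b
    = (- cheb (- B a b) (2 * Suc k)) *\<^sub>R a + (- cheb (- B a b) (Suc (2 * k))) *\<^sub>R b"
proof (induction k)
  case 0
  show ?case using assms by (simp add: rfl_self) (simp add: rfl_eq form_simps numeral_2_eq_2)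
next
  case (Suc k)
  have "((rfl a \<circ> rfl b) ^^ Suc (Suc k)) b
    = rfl a (rfl b ((- cheb (- B a b) (2 * Suc k)) *\<^sub>R a + (- cheb (- B a b) (Suc (2 * k))) *\<^sub>R b))"
    by (simp only: funpow.simps(2)[of "Suc k"] comp_apply Suc)
  also have "\<dots> = (- cheb (- B a b) (2 * Suc (Suc k))) *\<^sub>R a + (- cheb (- B a b) (Suc (2 * Suc k))) *\<^sub>R b"
    unfolding rfl_snd_pair[OF assms(2)] rfl_fst_pair[OF assms(1)]
    by (simp del: scaleR_minus_left add: algebra_simps)
  finally show ?case .
qed

text \<open>The plane of \<open>a\<close> and \<open>b\<close> is positive definite, so it splits off orthogonally; the coefficients
  come from Cramer's rule for the Gram matrix.\<close>
lemma orth_decomposition: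
  assumes "B a a = 1" "B b b = 1" "\<bar>B a b\<bar> < 1"
  obtains p q v' where "v = v' + p *\<^sub>R a + q *\<^sub>R b" "B a v' = 0" "B b v' = 0"
proof -
  define D where "D = 1 - B a b * B a b"
  have D: "D \<noteq> 0"
  proof -
    have "(B a b)\<^sup>2 < 1" using assms(3) by (simp add: abs_square_less_1)
    then show ?thesis by (simp add: D_def power2_eq_square)
  qed
  define p where "p = (B a v - B a b * B b v) / D"
  define q where "q = (B b v - B a b * B a v) / D"
  define v' where "v' = v - p *\<^sub>R a - q *\<^sub>R b"
  have pD: "p * D = B a v - B a b * B b v" and qD: "q * D = B b v - B a b * B a v"
    using D by (simp_all add: p_def q_def)
  have "D * (p + q * B a b) = D * B a v"
  proof -
    have "D * (p + q * B a b) = p * D + q * D * B a b" by (simp add: algebra_simps)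
    also have "\<dots> = D * B a v" unfolding pD qD by (simp add: D_def algebra_simps)
    finally show ?thesis .
  qed
  then have 1: "p + q * B a b = B a v" using D by simp
  have "D * (p * B a b + q) = D * B b v"
  proof -
    have "D * (p * B a b + q) = p * D * B a b + q * D" by (simp add: algebra_simps)
    also have "\<dots> = D * B b v" unfolding pD qD by (simp add: D_def algebra_simps)
    finally show ?thesis .
  qed
  then have 2: "p * B a b + q = B b v" using D by simp
  have "B a v' = 0" "B b v' = 0" using 1 2 assms sym[of b a]
    by (simp_all add: v'_def form_simps algebra_simps)
  moreover have "v = v' + p *\<^sub>R a + q *\<^sub>R b" by (simp add: v'_def)
  ultimately show ?thesis using that by blast
qed

text \<open>The product of the two reflections fixes the orthogonal complement of the plane pointwise and
  rotates the plane by \<open>2 \<pi> / m\<close>.\<close>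
lemma rotation_order:
  assumes ab: "B a a = 1" "B b b = 1" "B a b = - cos (pi / real m)" and m: "2 \<le> m"
  shows "(rfl a \<circ> rfl b) ^^ m = id"
proof
  fix v
  let ?t = "pi / real m" and ?R = "rfl a \<circ> rfl b"
  have t: "0 < ?t" "?t < pi" using m by (auto simp: field_simps)
  then have st: "0 < sin ?t" by (intro sin_gt_zero) auto
  have "\<bar>cos ?t\<bar> < 1" 
    using cos_monotone_0_pi[of 0 ?t] cos_monotone_0_pi[of ?t pi] t by (simp add: abs_less_iff)
  then obtain p q v' where v: "v = v' + p *\<^sub>R a + q *\<^sub>R b" and o: "B a v' = 0" "B b v' = 0"
    using orth_decomposition[of a b v] ab by (metis abs_minus_cancel)
  have lin: "linear (?R ^^ k)" for k
    by (induction k) (simp_all only: funpow.simps linear_id linear_compose[OF _ linear_compose[OF linear_rfl linear_rfl]])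
  have fix': "(?R ^^ k) v' = v'" for k
    by (induction k) (simp_all add: rfl_eq o)
  have mt: "real (2 * m) * ?t = 2 * pi" using m by simp
  have c0: "cheb (cos ?t) (2 * m) = 0"
    using sin_mult_cheb_cos[of ?t "2 * m"] st unfolding mt by simp
  have "real (Suc (2 * m)) * ?t = 2 * pi + ?t"
    using mt by (simp add: algebra_simps)
  then have c1: "cheb (cos ?t) (Suc (2 * m)) = 1"
    using sin_mult_cheb_cos[of ?t "Suc (2 * m)"] st by (simp add: sin_add del: cheb.simps)
  obtain l where l: "m = Suc l" using m by (cases m) auto
  have cm: "cheb (cos ?t) (Suc (2 * l)) = - 1"
    using c0 c1 unfolding l by simp
  have "(?R ^^ m) a = a" using rotation_power[of a b m] ab c0 c1 by simp
  moreover have "(?R ^^ m) b = b"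
    using rotation_power_snd[of a b l] ab c0 cm unfolding l by simp
  ultimately have "(?R ^^ m) v = v"
    unfolding v using fix'[of m] by (simp add: linear_add[OF lin] linear_scale[OF lin])
  then show "(?R ^^ m) v = id v" by simp
qed

end

section \<open>Words in the simple reflections and the positive cone\<close>

text \<open>The alternating word of length \<open>k\<close> in \<open>s\<close> and \<open>t\<close> that ends in \<open>t\<close>, read as a product of
  reflections acting from the left. Recursion adds letters at the front, the side on which words act last.\<close>
fun alternating :: "'g \<Rightarrow> 'g \<Rightarrow> nat \<Rightarrow> 'g list" where
  "alternating s t 0 = []"
| "alternating s t (Suc k) = (if even k then t else s) # alternating s t k"

lemma length_alternating: "length (alternating s t k) = k"
  by (induction k) auto

lemma set_alternating: "set (alternating s t k) \<subseteq> {s, t}"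
  by (induction k) auto

lemma alternating_suffix: "\<exists>pre. alternating s t (i + k) = pre @ alternating s t k \<and> length pre = i \<and> set pre \<subseteq> {s, t}"
proof (induction i)
  case (Suc i)
  then obtain pre where "alternating s t (i + k) = pre @ alternating s t k \<and> length pre = i \<and> set pre \<subseteq> {s, t}"
    by blast
  then show ?case by (intro exI[of _ "(if even (i + k) then t else s) # pre"]) auto
qed auto

text \<open>The notation \<open>inv\<close> denotes the inverse in a group structure here.\<close>
abbreviation fun_inv :: "('a \<Rightarrow> 'a) \<Rightarrow> 'a \<Rightarrow> 'a" where
  "fun_inv f \<equiv> inv_into UNIV f"

text \<open>The hypotheses on the form and on the simple roots of a geometric representation, without the
  abstract group. The signs of roots depend only on the linear maps that the simple reflections generate.\<close>
locale root_basis = sym_form B for B :: "'v::real_vector \<Rightarrow> 'v \<Rightarrow> real" +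
  fixes S :: "'g set" and a :: "'g \<Rightarrow> 'v"
  assumes finite_S: "finite S"
    and pos_indep: "\<And>c. \<forall>s\<in>S. 0 \<le> c s \<Longrightarrow> (\<Sum>s\<in>S. c s *\<^sub>R a s) = 0 \<Longrightarrow> \<forall>s\<in>S. c s = 0"
    and norm1: "s \<in> S \<Longrightarrow> B (a s) (a s) = 1"
    and offdiag: "s \<in> S \<Longrightarrow> t \<in> S \<Longrightarrow> s \<noteq> t \<Longrightarrow>
      B (a s) (a t) \<in> {..-1} \<union> {- cos (pi / real k) | k::nat. k \<ge> 2}"
begin

definition word_act :: "'g list \<Rightarrow> 'v \<Rightarrow> 'v" where
  "word_act ws = foldr (\<lambda>s f. rfl (a s) \<circ> f) ws id"

text \<open>The image of the Coxeter group in the linear group; the simple reflections are involutions, so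
  words without inverses suffice.\<close>
definition G :: "('v \<Rightarrow> 'v) set" where
  "G = word_act ` lists S"

abbreviation cone :: "'v set" where "cone \<equiv> nonneg_cone (a ` S)"

lemma word_act_Nil: "word_act [] = id"
  and word_act_Cons: "word_act (s # ws) = rfl (a s) \<circ> word_act ws"
  by (simp_all add: word_act_def)

lemma word_act_append: "word_act (us @ vs) = word_act us \<circ> word_act vs"
  by (induction us) (simp_all add: word_act_Nil word_act_Cons comp_assoc)

lemma word_act_rev: "ws \<in> lists S \<Longrightarrow> word_act (rev ws) \<circ> word_act ws = id"
proof (induction ws)
  case (Cons s ws)
  have "word_act (rev (s # ws)) \<circ> word_act (s # ws)
    = word_act (rev ws) \<circ> (rfl (a s) \<circ> rfl (a s)) \<circ> word_act ws"
    by (simp add: word_act_append word_act_Cons word_act_Nil comp_assoc)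
  then show ?case using Cons by (simp add: rfl_involution norm1)
qed (simp add: word_act_Nil)

lemma G_I: "ws \<in> lists S \<Longrightarrow> word_act ws \<in> G"
  by (auto simp: G_def)

lemma id_G: "id \<in> G"
  using G_I[of "[]"] by (simp add: word_act_Nil)

lemma comp_G: "f \<in> G \<Longrightarrow> g \<in> G \<Longrightarrow> f \<circ> g \<in> G"
proof -
  assume "f \<in> G" "g \<in> G"
  then obtain us vs where "us \<in> lists S" "f = word_act us" "vs \<in> lists S" "g = word_act vs"
    unfolding G_def by blast
  then show ?thesis using G_I[of "us @ vs"] by (simp add: word_act_append)
qed

lemma rfl_simple_G: "s \<in> S \<Longrightarrow> rfl (a s) \<in> G"
  using G_I[of "[s]"] by (simp add: word_act_Nil word_act_Cons)

lemma bij_G: "f \<in> G \<Longrightarrow> bij f"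
  and inv_G: "f \<in> G \<Longrightarrow> fun_inv f \<in> G"
proof -
  have "bij (word_act ws) \<and> fun_inv (word_act ws) = word_act (rev ws)" if "ws \<in> lists S" for ws
  proof -
    have 1: "word_act (rev ws) \<circ> word_act ws = id" "word_act ws \<circ> word_act (rev ws) = id"
      using word_act_rev[of ws] word_act_rev[of "rev ws"] that by (simp_all add: in_lists_conv_set)
    show ?thesis using o_bij[OF 1] inv_unique_comp[OF 1(2) 1(1)] by simp
  qed
  note word = this
  assume "f \<in> G"
  then obtain ws where "f = word_act ws" "ws \<in> lists S" by (auto simp: G_def)
  then show "bij f" "fun_inv f \<in> G"
    using word[of ws] G_I[of "rev ws"] by (simp_all add: in_lists_conv_set)
qed

lemma inv_G_simps:
  assumes "f \<in> G"
  shows "f (fun_inv f x) = x" "fun_inv f (f x) = x"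
  using bij_G[OF assms] by (simp_all add: bij_is_surj surj_f_inv_f bij_is_inj)

lemma linear_G: "f \<in> G \<Longrightarrow> linear f"
proof -
  have "linear (word_act ws)" for ws
    by (induction ws) (simp_all only: word_act_Nil word_act_Cons linear_id linear_compose[OF _ linear_rfl])
  then show "f \<in> G \<Longrightarrow> linear f" by (auto simp: G_def)
qed

lemma isometry_G: "f \<in> G \<Longrightarrow> B (f x) (f y) = B x y"
proof -
  have "ws \<in> lists S \<Longrightarrow> B (word_act ws x) (word_act ws y) = B x y" for ws
    by (induction ws) (simp_all add: word_act_Nil word_act_Cons form_rfl norm1)
  then show "f \<in> G \<Longrightarrow> B (f x) (f y) = B x y" by (auto simp: G_def)
qed

lemmas lin_G = linear_add[OF linear_G] linear_diff[OF linear_G] linear_scale[OF linear_G]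
  linear_neg[OF linear_G] linear_0[OF linear_G]

lemma form_simple_nonpos: "s \<in> S \<Longrightarrow> t \<in> S \<Longrightarrow> s \<noteq> t \<Longrightarrow> B (a s) (a t) \<le> 0"
proof -
  assume "s \<in> S" "t \<in> S" "s \<noteq> t"
  from offdiag[OF this] consider "B (a s) (a t) \<le> -1"
    | k :: nat where "k \<ge> 2" "B (a s) (a t) = - cos (pi / real k)" by auto
  then show ?thesis
  proof cases
    case 2
    then have "pi / real k \<le> pi / 2" by (intro divide_left_mono) auto
    moreover have "0 \<le> pi / real k" by simp
    ultimately have "0 \<le> cos (pi / real k)" by (intro cos_ge_zero) linarith+
    then show ?thesis using 2 by simp
  qed auto
qed

lemma inj_simple: "inj_on a S"
  using form_simple_nonpos norm1 by (intro inj_onI) (metis not_one_le_zero)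

lemma cone_iff: "x \<in> cone \<longleftrightarrow> (\<exists>c. (\<forall>s\<in>S. 0 \<le> c s) \<and> x = (\<Sum>s\<in>S. c s *\<^sub>R a s))"
proof
  assume "x \<in> cone"
  then obtain F c where F: "finite F" "F \<subseteq> a ` S" "\<forall>v\<in>F. 0 \<le> c v" "x = (\<Sum>v\<in>F. c v *\<^sub>R v)"
    by (auto simp: nonneg_cone_def)
  define d where "d = (\<lambda>v. if v \<in> F then c v else 0)"
  have "x = (\<Sum>v\<in>a ` S. d v *\<^sub>R v)"
    unfolding F(4) by (rule sum.mono_neutral_cong_left) (use F finite_S in \<open>auto simp: d_def\<close>)
  also have "\<dots> = (\<Sum>s\<in>S. d (a s) *\<^sub>R a s)"
    by (simp add: sum.reindex[OF inj_simple])
  finally show "\<exists>c. (\<forall>s\<in>S. 0 \<le> c s) \<and> x = (\<Sum>s\<in>S. c s *\<^sub>R a s)"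
    using F(3) by (intro exI[of _ "\<lambda>s. d (a s)"]) (auto simp: d_def)
next
  assume "\<exists>c. (\<forall>s\<in>S. 0 \<le> c s) \<and> x = (\<Sum>s\<in>S. c s *\<^sub>R a s)"
  then obtain c where c: "\<forall>s\<in>S. 0 \<le> c s" "x = (\<Sum>s\<in>S. c s *\<^sub>R a s)" by blast
  have "x = (\<Sum>v\<in>a ` S. c (inv_into S a v) *\<^sub>R v)"
    unfolding c(2) by (simp add: sum.reindex[OF inj_simple] inv_into_f_f[OF inj_simple])
  then show "x \<in> cone"
    unfolding nonneg_cone_def using c(1) finite_S inj_simple
    by (auto intro!: exI[of _ "a ` S"] exI[of _ "\<lambda>v. c (inv_into S a v)"])
qed

lemma cone_add: "x \<in> cone \<Longrightarrow> y \<in> cone \<Longrightarrow> x + y \<in> cone"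
  unfolding cone_iff
proof (elim exE conjE)
  fix c d assume "\<forall>s\<in>S. 0 \<le> c s" "x = (\<Sum>s\<in>S. c s *\<^sub>R a s)" "\<forall>s\<in>S. 0 \<le> d s" "y = (\<Sum>s\<in>S. d s *\<^sub>R a s)"
  then show "\<exists>c. (\<forall>s\<in>S. 0 \<le> c s) \<and> x + y = (\<Sum>s\<in>S. c s *\<^sub>R a s)"
    by (intro exI[of _ "\<lambda>s. c s + d s"]) (auto simp: sum.distrib scaleR_left_distrib)
qed

lemma cone_scale: "0 \<le> r \<Longrightarrow> x \<in> cone \<Longrightarrow> r *\<^sub>R x \<in> cone"
  unfolding cone_iff
proof (elim exE conjE)
  fix c assume "0 \<le> r" "\<forall>s\<in>S. 0 \<le> c s" "x = (\<Sum>s\<in>S. c s *\<^sub>R a s)"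
  then show "\<exists>c. (\<forall>s\<in>S. 0 \<le> c s) \<and> r *\<^sub>R x = (\<Sum>s\<in>S. c s *\<^sub>R a s)"
    by (intro exI[of _ "\<lambda>s. r * c s"]) (auto simp: scaleR_sum_right)
qed

lemma simple_cone: "s \<in> S \<Longrightarrow> a s \<in> cone"
  unfolding nonneg_cone_def by (auto intro!: exI[of _ "{a s}"] exI[of _ "\<lambda>_. 1"])

text \<open>Adding the expressions of \<open>x\<close> and \<open>- x\<close> gives a relation between the simple roots with nonnegative
  coefficients. The simple roots may be linearly dependent, but such a relation is trivial.\<close>
lemma cone_salient: "x \<in> cone \<Longrightarrow> - x \<in> cone \<Longrightarrow> x = 0"
proof -
  assume "x \<in> cone" "- x \<in> cone"
  then obtain c d where c: "\<forall>s\<in>S. 0 \<le> c s" "x = (\<Sum>s\<in>S. c s *\<^sub>R a s)"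
      and d: "\<forall>s\<in>S. 0 \<le> d s" "- x = (\<Sum>s\<in>S. d s *\<^sub>R a s)" by (auto simp: cone_iff)
  have "(\<Sum>s\<in>S. (c s + d s) *\<^sub>R a s) = x + - x"
    unfolding scaleR_left_distrib sum.distrib c(2)[symmetric] d(2)[symmetric] by (rule refl)
  then have "(\<Sum>s\<in>S. (c s + d s) *\<^sub>R a s) = 0" by simp
  then have "\<forall>s\<in>S. c s + d s = 0" using c d by (intro pos_indep) auto
  then have "\<forall>s\<in>S. c s = 0" using c d by (metis add_nonneg_eq_0_iff)
  then show ?thesis using c by simp
qed

text \<open>If \<open>a t\<close> were a nonnegative combination of the other simple roots, pairing with \<open>a t\<close> would give
  \<open>1 \<le> 0\<close>. So the excess of \<open>a t\<close> in \<open>u + v\<close> can be moved to the side of the other simple roots with a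
  nonnegative coefficient, and positive independence kills all of them.\<close>
lemma simple_ray_extremal:
  assumes t: "t \<in> S" and u: "u \<in> cone" "v \<in> cone" "u + v = k *\<^sub>R a t"
  shows "\<exists>r. u = r *\<^sub>R a t"
proof -
  obtain c d where c: "\<forall>s\<in>S. 0 \<le> c s" "u = (\<Sum>s\<in>S. c s *\<^sub>R a s)"
      and d: "\<forall>s\<in>S. 0 \<le> d s" "v = (\<Sum>s\<in>S. d s *\<^sub>R a s)" using u by (auto simp: cone_iff)
  define e where "e = (\<lambda>s. c s + d s)"
  let ?E = "\<Sum>s\<in>S - {t}. e s *\<^sub>R a s"
  have "k *\<^sub>R a t = (\<Sum>s\<in>S. e s *\<^sub>R a s)"
    unfolding u(3)[symmetric] c(2) d(2) e_def by (simp add: scaleR_left_distrib sum.distrib)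
  also have "\<dots> = e t *\<^sub>R a t + ?E"
    using sum.remove[OF finite_S t] by blast
  finally have E: "?E = (k - e t) *\<^sub>R a t" by (simp add: scaleR_left_diff_distrib)
  have "B (a t) ?E = (\<Sum>s\<in>S - {t}. e s * B (a t) (a s))"
    by (subst linear_sum[of "B (a t)"]) (use bilin in \<open>auto simp: bilinear_def form_simps\<close>)
  also have "\<dots> \<le> 0"
    using c d t form_simple_nonpos[of t] by (intro sum_nonpos) (auto simp: e_def mult_nonneg_nonpos)
  finally have "k - e t \<le> 0" unfolding E using norm1[OF t] by (simp add: form_simps)
  \<comment> \<open>the relation between simple roots, with the excess \<open>e t - k \<ge> 0\<close> at \<open>t\<close>\<close>
  define e' where "e' = e(t := e t - k)"
  have "(\<Sum>s\<in>S. e' s *\<^sub>R a s) = (e t - k) *\<^sub>R a t + ?E"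
    by (subst sum.remove[OF finite_S t]) (auto simp: e'_def intro!: sum.cong)
  also have "\<dots> = 0" unfolding E by (simp add: scaleR_left_diff_distrib)
  finally have "\<forall>s\<in>S. e' s = 0"
    using \<open>k - e t \<le> 0\<close> c d by (intro pos_indep) (auto simp: e'_def e_def)
  then have "c s = 0" if "s \<in> S - {t}" for s
    using that c(1) d(1) by (auto simp: e'_def e_def add_nonneg_eq_0_iff dest!: bspec[of _ _ s])
  then have "u = c t *\<^sub>R a t"
    unfolding c(2) by (subst sum.remove[OF finite_S t]) simp
  then show ?thesis by blast
qed

section \<open>Length and the images of simple roots\<close>

definition word_length :: "('v \<Rightarrow> 'v) \<Rightarrow> nat" where
  "word_length f = (LEAST n. \<exists>ws\<in>lists S. length ws = n \<and> word_act ws = f)"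

lemma word_length_attained: "f \<in> G \<Longrightarrow> \<exists>ws\<in>lists S. length ws = word_length f \<and> word_act ws = f"
  unfolding word_length_def by (rule LeastI_ex) (auto simp: G_def)

lemma word_length_le: "ws \<in> lists S \<Longrightarrow> word_length (word_act ws) \<le> length ws"
  unfolding word_length_def by (rule Least_le) auto

lemma word_length_comp: "f \<in> G \<Longrightarrow> ws \<in> lists S \<Longrightarrow> word_length (f \<circ> word_act ws) \<le> word_length f + length ws"
proof -
  assume "f \<in> G" "ws \<in> lists S"
  moreover obtain us where "us \<in> lists S" "length us = word_length f" "word_act us = f"
    using word_length_attained \<open>f \<in> G\<close> by blast
  ultimately show ?thesis using word_length_le[of "us @ ws"] by (auto simp: word_act_append)
qed

lemma alternating_lists: "s \<in> S \<Longrightarrow> t \<in> S \<Longrightarrow> alternating s t k \<in> lists S"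
  using set_alternating[of s t k] by (auto simp: in_lists_conv_set)

lemma word_act_alternating_simple:
  assumes "s \<in> S" "t \<in> S"
  defines "c \<equiv> - B (a s) (a t)"
  shows "word_act (alternating s t k) (a s) =
    (if even k then cheb c (Suc k) *\<^sub>R a s + cheb c k *\<^sub>R a t
     else cheb c k *\<^sub>R a s + cheb c (Suc k) *\<^sub>R a t)"
proof (induction k)
  case (Suc k)
  show ?case
  proof (cases "even k")
    case True
    then show ?thesis using Suc rfl_snd_pair[OF norm1[OF assms(2)]]
      by (simp add: word_act_Cons c_def)
  next
    case False
    then show ?thesis using Suc rfl_fst_pair[OF norm1[OF assms(1)]]
      by (simp add: word_act_Cons c_def)
  qed
qed (simp add: word_act_Nil)

lemma word_act_alternating_even: "word_act (alternating s t (2 * k)) = (rfl (a s) \<circ> rfl (a t)) ^^ k"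
proof (induction k)
  case (Suc k)
  then show ?case by (simp add: word_act_Cons comp_assoc)
qed (simp add: word_act_Nil)

text \<open>In a dihedral group of order \<open>2 m\<close>, an alternating word with \<open>m + 1\<close> letters has the
  complementary alternating word with \<open>m - 1\<close> letters as another expression.\<close>
lemma alternating_order_shortening:
  assumes st: "s \<in> S" "t \<in> S" and m: "2 \<le> m" "B (a s) (a t) = - cos (pi / real m)"
  shows "\<exists>ys\<in>lists S. length ys = m - 1 \<and> word_act (alternating s t m) \<circ> rfl (a s) = word_act ys"
proof -
  obtain zs where zs: "alternating s t (m + m) = zs @ alternating s t m" "length zs = m" "set zs \<subseteq> {s, t}"
    using alternating_suffix[of s t m m] by blast
  obtain m' where m': "m + m = Suc m'" "odd m'" using m
    by (metis even_Suc even_add not0_implies_Suc not_numeral_le_zero add_is_0)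
  obtain ys where ys: "zs = s # ys"
    using zs m' m by (cases zs) auto
  have ysS: "ys \<in> lists S" using zs(3) ys st by (auto simp: in_lists_conv_set)
  have "id = word_act (alternating s t (m + m))"
    using word_act_alternating_even[of s t m] rotation_order[of "a s" "a t" m] st m norm1
    by (simp add: mult_2)
  also have "\<dots> = rfl (a s) \<circ> (word_act ys \<circ> word_act (alternating s t m))"
    unfolding zs(1) ys by (simp add: word_act_append word_act_Cons comp_assoc)
  finally have 1: "rfl (a s) \<circ> (word_act ys \<circ> word_act (alternating s t m)) = id" by simp
  have "word_act (alternating s t m) = word_act (rev ys) \<circ> (rfl (a s) \<circ> rfl (a s)) \<circ> word_act ys \<circ> word_act (alternating s t m)"
    using word_act_rev[OF ysS] by (simp add: rfl_involution norm1 st)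
  also have "\<dots> = word_act (rev ys) \<circ> rfl (a s) \<circ> (rfl (a s) \<circ> (word_act ys \<circ> word_act (alternating s t m)))"
    by (simp only: comp_assoc)
  also have "\<dots> = word_act (rev ys) \<circ> rfl (a s)"
    unfolding 1 by simp
  finally have "word_act (alternating s t m) \<circ> rfl (a s) = word_act (rev ys) \<circ> (rfl (a s) \<circ> rfl (a s))"
    by (simp add: comp_assoc)
  then show ?thesis using ysS zs ys
    by (intro bexI[of _ "rev ys"]) (auto simp: rfl_involution norm1 st)
qed

text \<open>Induction on the length. Strip from the end of a shortest word for \<open>f\<close> the longest possible suffix
  that alternates in \<open>s\<close> and the last letter \<open>t\<close>, which leaves \<open>v\<close>. Neither \<open>s\<close> nor \<open>t\<close> shortens \<open>v\<close>, so \<open>v\<close> maps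
  both simple roots into the cone by induction. The suffix maps \<open>a s\<close> to a combination of the two
  with Chebyshev coefficients. They are nonnegative: a suffix long enough to make one of them negative
  could be shortened by the dihedral relation, and then \<open>s\<close> would shorten \<open>f\<close>.\<close>
theorem ascent_image_in_cone:
  assumes "f \<in> G" "s \<in> S" "word_length f \<le> word_length (f \<circ> rfl (a s))"
  shows "f (a s) \<in> cone"
  using assms
proof (induction "word_length f" arbitrary: f s rule: less_induct)
  case less
  note f = \<open>f \<in> G\<close> and s = \<open>s \<in> S\<close>
  obtain ws where ws: "ws \<in> lists S" "length ws = word_length f" "word_act ws = f"
    using word_length_attained f by blast
  show ?case
  proof (cases ws rule: rev_cases)
    case Nil
    then show ?thesis using ws simple_cone[OF s] by (simp add: word_act_Nil)
  next
    case (snoc ws' t)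
    have t: "t \<in> S" and ws': "ws' \<in> lists S" using ws snoc by auto
    define g where "g = word_act ws'"
    have g: "g \<in> G" "f = g \<circ> rfl (a t)" 
      using ws ws' snoc by (auto simp: g_def G_I word_act_append word_act_Cons word_act_Nil)
    have gl: "word_length g + 1 \<le> word_length f" using word_length_le[OF ws'] ws snoc by (simp add: g_def)
    have "t \<noteq> s"
    proof
      assume "t = s"
      then have "f \<circ> rfl (a s) = g" using g t by (simp add: comp_assoc rfl_involution norm1)
      then show False using gl less.prems by simp
    qed
    \<comment> \<open>\<open>P j\<close>: a factor of length \<open>j\<close> alternating in \<open>s\<close> and \<open>t\<close> can be split off without loss of length\<close>
    define P where "P j \<longleftrightarrow> (\<exists>v\<in>G. f = v \<circ> word_act (alternating s t j) \<and> word_length v + j \<le> word_length f)" for j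
    have Pb: "P j \<Longrightarrow> j \<le> word_length f" for j by (auto simp: P_def)
    have P1: "P 1" using g gl by (auto simp: P_def word_act_Cons word_act_Nil intro!: bexI[of _ g])
    define j where "j = (GREATEST j. P j)"
    have Pj: "P j" unfolding j_def by (rule GreatestI_nat[of P 1, OF P1]) (use Pb in blast)
    have nP: "\<not> P (Suc j)"
      unfolding j_def using Greatest_le_nat[of P "Suc j" "word_length f"] Pb j_def by auto
    have "1 \<le> j" unfolding j_def by (rule Greatest_le_nat[of P 1, OF P1]) (use Pb in blast)
    then obtain i where i: "j = Suc i" by (cases j) auto
    from Pj obtain v where v: "v \<in> G" "f = v \<circ> word_act (alternating s t j)" "word_length v + j \<le> word_length f"
      by (auto simp: P_def)
    have fv: "word_length f \<le> word_length v + j"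
      using word_length_comp[OF v(1) alternating_lists[OF s t, of j]] v(2) by (simp add: length_alternating)
    \<comment> \<open>\<open>u\<close> would be the next letter of the alternating suffix, \<open>u'\<close> is its first letter\<close>
    define u where "u = (if even j then t else s)"
    define u' where "u' = (if even i then t else s)"
    have uS: "u \<in> S" "u' \<in> S" and uu: "{u, u'} = {s, t}" using s t by (auto simp: u_def u'_def i)
    have "word_length v \<le> word_length (v \<circ> rfl (a u))"
    proof (rule ccontr)
      assume "\<not> ?thesis"
      then have "word_length (v \<circ> rfl (a u)) + Suc j \<le> word_length f" using v(3) by simp
      moreover have "f = (v \<circ> rfl (a u)) \<circ> word_act (alternating s t (Suc j))"
        unfolding v(2) by (simp add: fun_eq_iff word_act_Cons u_def rfl_rfl norm1 s t)
      ultimately have "P (Suc j)" unfolding P_def using v(1) uS comp_G rfl_simple_G by blast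
      then show False using nP by simp
    qed
    moreover have "word_length v \<le> word_length (v \<circ> rfl (a u'))"
    proof -
      have "f = (v \<circ> rfl (a u')) \<circ> word_act (alternating s t i)"
        unfolding v(2) i by (simp add: fun_eq_iff word_act_Cons u'_def)
      then have "word_length f \<le> word_length (v \<circ> rfl (a u')) + i"
        using word_length_comp[OF _ alternating_lists[OF s t, of i]] v(1) uS comp_G rfl_simple_G by (metis length_alternating)
      then show ?thesis using v(3) i by simp
    qed
    moreover have "word_length v < word_length f" using v(3) i by simp
    ultimately have "v (a u) \<in> cone" "v (a u') \<in> cone"
      using less.hyps[of v u] less.hyps[of v u'] v(1) uS by auto
    then have vst: "v (a s) \<in> cone" "v (a t) \<in> cone" using uu by (auto simp: doubleton_eq_iff)
    define c where "c = - B (a s) (a t)"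
    have c0: "0 \<le> cheb c j \<and> 0 \<le> cheb c (Suc j)"
    proof -
      from offdiag[OF s t] \<open>t \<noteq> s\<close> consider "1 \<le> c"
        | k :: nat where "k \<ge> 2" "c = cos (pi / real k)" by (auto simp: c_def)
      then show ?thesis
      proof cases
        case 1
        then show ?thesis using cheb_strict_mono[of c j] cheb_strict_mono[of c "Suc j"] by linarith
      next
        case 2
        have "j < k"
        proof (rule ccontr)
          assume "\<not> j < k"
          then obtain pre where pre: "alternating s t j = pre @ alternating s t k" "length pre = j - k" "set pre \<subseteq> {s, t}"
            using alternating_suffix[of s t "j - k" k] by auto
          have preS: "pre \<in> lists S" using pre s t by (auto simp: in_lists_conv_set)
          obtain ys where ys: "ys \<in> lists S" "length ys = k - 1"
              "word_act (alternating s t k) \<circ> rfl (a s) = word_act ys"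
            using alternating_order_shortening[OF s t, of k] 2 by (auto simp: c_def)
          have "f \<circ> rfl (a s) = v \<circ> word_act pre \<circ> (word_act (alternating s t k) \<circ> rfl (a s))"
            unfolding v(2) pre(1) by (simp add: word_act_append comp_assoc)
          also have "\<dots> = v \<circ> word_act (pre @ ys)" unfolding ys(3)
            by (simp add: word_act_append comp_assoc)
          finally have "word_length (f \<circ> rfl (a s)) \<le> word_length v + length (pre @ ys)"
            using word_length_comp[OF v(1), of "pre @ ys"] preS ys(1) by simp
          also have "\<dots> < word_length v + j" using pre(2) ys(2) \<open>\<not> j < k\<close> 2(1) by simp
          also have "\<dots> \<le> word_length f" by (rule v(3))
          finally show False using less.prems by simp
        qed
        have t0: "0 < pi / real k" using 2 by simp
        have kp: "real k * (pi / real k) = pi" using 2 by simp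
        have "real j * (pi / real k) < real k * (pi / real k)" 
          using \<open>j < k\<close> 2 t0 by (intro mult_strict_right_mono) auto
        then have a1: "0 \<le> cheb c j"
          using cheb_cos_pos[OF t0, of j] \<open>1 \<le> j\<close> 2(2) kp by auto
        \<comment> \<open>the only zero coefficient occurs at \<open>j + 1 = k\<close>, where \<open>sin \<pi> = 0\<close>\<close>
        show ?thesis
        proof (cases "Suc j = k")
          case True
          have "0 < sin (pi / real k)" using 2 by (intro sin_gt_zero) (auto simp: field_simps)
          then have "cheb c (Suc j) = 0" using sin_mult_cheb_cos[of "pi / real k" k] True kp 2(2)
            by (metis mult_eq_0_iff sin_pi less_irrefl)
          then show ?thesis using a1 by simp
        next
          case False
          then have "real (Suc j) * (pi / real k) < real k * (pi / real k)" 
            using \<open>j < k\<close> 2 t0 by (intro mult_strict_right_mono) auto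
          then show ?thesis using a1 cheb_cos_pos[OF t0, of "Suc j"] 2(2) kp by auto
        qed
      qed
    qed
    have "f (a s) = v (word_act (alternating s t j) (a s))" using v(2) by simp
    also have "\<dots> \<in> cone"
      unfolding word_act_alternating_simple[OF s t] c_def[symmetric] using c0 vst
      by (auto simp: lin_G[OF v(1)] intro!: cone_add cone_scale)
    finally show ?thesis .
  qed
qed

section \<open>Positive and negative roots\<close>

definition Phi :: "'v set" where "Phi = {f (a s) | f s. f \<in> G \<and> s \<in> S}"
definition pos :: "'v set" where "pos = cone \<inter> Phi"
definition neg :: "'v set" where "neg = uminus ` pos"

lemma PhiE:
  assumes "x \<in> Phi" obtains f s where "f \<in> G" "s \<in> S" "x = f (a s)"
  using assms by (auto simp: Phi_def)

lemma simple_Phi: "s \<in> S \<Longrightarrow> a s \<in> Phi"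
  unfolding Phi_def using id_G by (auto intro!: exI[of _ id])

lemma G_Phi: "f \<in> G \<Longrightarrow> x \<in> Phi \<Longrightarrow> f x \<in> Phi"
  by (erule PhiE) (auto simp: Phi_def intro!: exI[of _ "f \<circ> _"] comp_G)

lemma norm_Phi: "x \<in> Phi \<Longrightarrow> B x x = 1"
  by (erule PhiE) (simp add: isometry_G norm1)

lemma nonzero_Phi: "x \<in> Phi \<Longrightarrow> x \<noteq> 0"
  using norm_Phi[of x] by (auto simp: form_simps)

lemma uminus_Phi: "x \<in> Phi \<Longrightarrow> - x \<in> Phi"
proof (erule PhiE)
  fix f s assume "f \<in> G" "s \<in> S" "x = f (a s)"
  moreover from this have "- x = f (rfl (a s) (a s))"
    by (simp add: rfl_self norm1 lin_G)
  ultimately show ?thesis using G_Phi rfl_simple_G simple_Phi by simp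
qed

lemma rfl_G: "x \<in> Phi \<Longrightarrow> rfl x \<in> G"
proof (erule PhiE)
  fix f s assume fs: "f \<in> G" "s \<in> S" "x = f (a s)"
  have "rfl x = f \<circ> rfl (a s) \<circ> fun_inv f"
  proof
    fix v
    have "f (rfl (a s) (fun_inv f v)) = rfl (f (a s)) (f (fun_inv f v))"
      using fs by (intro isometry_rfl linear_G isometry_G)
    then show "rfl x v = (f \<circ> rfl (a s) \<circ> fun_inv f) v" using fs by (simp add: inv_G_simps)
  qed
  then show ?thesis using fs comp_G inv_G rfl_simple_G by metis
qed

lemma rfl_Phi: "x \<in> Phi \<Longrightarrow> y \<in> Phi \<Longrightarrow> rfl x y \<in> Phi"
  using rfl_G G_Phi by blast

lemma pos_Phi: "x \<in> pos \<Longrightarrow> x \<in> Phi"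
  and pos_cone: "x \<in> pos \<Longrightarrow> x \<in> cone"
  by (auto simp: pos_def)

lemma neg_iff: "x \<in> neg \<longleftrightarrow> - x \<in> pos"
  unfolding neg_def by (metis image_iff minus_minus)

lemma uminus_neg_iff: "- x \<in> neg \<longleftrightarrow> x \<in> pos"
  by (simp add: neg_iff)

lemma pos_not_neg: "x \<in> pos \<Longrightarrow> x \<notin> neg"
  unfolding neg_iff using cone_salient pos_cone nonzero_Phi pos_Phi by blast

text \<open>Apply the preceding theorem to the shorter one of \<open>f\<close> and \<open>f s\<close>, which map \<open>a s\<close> to opposite roots.\<close>
theorem Phi_pos_or_neg:
  assumes "x \<in> Phi" shows "x \<in> pos \<or> x \<in> neg"
proof -
  obtain f s where fs: "f \<in> G" "s \<in> S" "x = f (a s)" using assms by (rule PhiE)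
  let ?g = "f \<circ> rfl (a s)"
  have g: "?g \<in> G" "?g \<circ> rfl (a s) = f" "?g (a s) = - x"
    using fs by (simp_all add: comp_G rfl_simple_G comp_assoc rfl_involution rfl_self norm1 lin_G)
  have "x \<in> cone \<or> - x \<in> cone"
    using ascent_image_in_cone[OF fs(1,2)] ascent_image_in_cone[OF g(1) fs(2)] g fs(3)
    by (metis nle_le)
  then show ?thesis using assms uminus_Phi by (auto simp: pos_def neg_iff)
qed

lemma simple_pos: "s \<in> S \<Longrightarrow> a s \<in> pos"
  by (simp add: pos_def simple_Phi simple_cone)

lemma not_pos_iff: "x \<in> Phi \<Longrightarrow> x \<notin> pos \<longleftrightarrow> x \<in> neg"
  using Phi_pos_or_neg pos_not_neg by blast

text \<open>Roots have norm one, so the root system is reduced.\<close>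
lemma pos_multiple:
  assumes "x \<in> pos" "y \<in> pos" "x = r *\<^sub>R y"
  shows "x = y"
proof -
  have "r * r = 1" using norm_Phi[of x] norm_Phi[of y] assms pos_Phi by (simp add: form_simps)
  then have "r = 1 \<or> r = -1" by (simp add: square_eq_1_iff)
  moreover have "r \<noteq> -1" using assms pos_not_neg[of y] by (auto simp: neg_iff)
  ultimately show ?thesis using assms by auto
qed

lemma pos_combination:
  assumes "x \<in> Phi" "y \<in> pos" "z \<in> pos" "0 \<le> p" "0 \<le> q" "x = p *\<^sub>R y + q *\<^sub>R z"
  shows "x \<in> pos"
  using assms by (auto simp: pos_def intro!: cone_add cone_scale)

lemma simple_extremal_pos:
  assumes "t \<in> S" "x \<in> pos" "y \<in> cone" "0 < q" "q *\<^sub>R x + y = k *\<^sub>R a t"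
  shows "x = a t"
proof -
  obtain r where "q *\<^sub>R x = r *\<^sub>R a t"
    using simple_ray_extremal[OF assms(1) _ assms(3,5)] assms cone_scale pos_cone by force
  then have "x = (r / q) *\<^sub>R a t" using assms(4)
    by (metis divide_inverse_commute less_irrefl scaleR_cancel_left scaleR_scaleR nonzero_mult_div_cancel_left times_divide_eq_right)
  then show ?thesis using pos_multiple assms simple_pos by blast
qed

text \<open>Otherwise \<open>x\<close> and the positive root \<open>- s\<^sub>t x\<close> would add up to a multiple of \<open>a t\<close>, which spans an
  extremal ray of the cone.\<close>
lemma simple_rfl_pos:
  assumes "t \<in> S" "x \<in> pos" "x \<noteq> a t"
  shows "rfl (a t) x \<in> pos"
proof (rule ccontr)
  assume "\<not> ?thesis"
  then have "- rfl (a t) x \<in> pos"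
    using not_pos_iff rfl_Phi simple_Phi pos_Phi assms by (metis neg_iff)
  moreover have "1 *\<^sub>R x + - rfl (a t) x = (2 * B (a t) x) *\<^sub>R a t" by (simp add: rfl_eq)
  ultimately show False using simple_extremal_pos[OF assms(1,2) pos_cone zero_less_one] assms(3) by blast
qed

lemma G_word_induct [consumes 1, case_names id rfl]:
  assumes "f \<in> G" "P id" "\<And>s f. s \<in> S \<Longrightarrow> f \<in> G \<Longrightarrow> P f \<Longrightarrow> P (rfl (a s) \<circ> f)"
  shows "P f"
proof -
  have "ws \<in> lists S \<Longrightarrow> P (word_act ws)" for ws
    by (induction ws) (use assms(2,3) G_I in \<open>auto simp: word_act_Nil word_act_Cons\<close>)
  then show ?thesis using assms(1) by (auto simp: G_def)
qed

text \<open>Every positive root is reached from a simple root through positive roots by simple reflections: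
  in a word that produces it, a partial product can turn negative only by passing through a simple
  root, and one may start again there.\<close>
lemma pos_root_induct [consumes 1, case_names simple rfl]:
  assumes "x \<in> pos" "\<And>s. s \<in> S \<Longrightarrow> P (a s)"
    and "\<And>t y. t \<in> S \<Longrightarrow> y \<in> pos \<Longrightarrow> y \<noteq> a t \<Longrightarrow> P y \<Longrightarrow> P (rfl (a t) y)"
  shows "P x"
proof -
  obtain f s where "f \<in> G" "s \<in> S" "x = f (a s)" using assms(1) pos_Phi by (blast elim: PhiE)
  then show ?thesis using assms(1)
  proof (induction f arbitrary: x rule: G_word_induct)
    case id
    then show ?case using assms(2) by simp
  next
    case (rfl t f)
    show ?case
    proof (cases "x = a t")
      case False
      define y where "y = rfl (a t) x"
      have "y \<in> pos" unfolding y_def using False rfl simple_rfl_pos[of t x] by blast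
      then have y: "y \<in> pos" "rfl (a t) y = x" "y = f (a s)"
        using rfl by (simp_all add: y_def rfl_rfl norm1)
      have "y \<noteq> a t"
      proof
        assume "y = a t"
        then have "- x = a t" using y(2) rfl_self norm1 \<open>t \<in> S\<close> by force
        then show False using pos_not_neg[of x] \<open>x \<in> pos\<close> simple_pos \<open>t \<in> S\<close> by (simp add: neg_iff)
      qed
      then show ?thesis using assms(3)[of t y] rfl y by auto
    qed (use assms(2) rfl in simp)
  qed
qed

lemma finite_inversions: "f \<in> G \<Longrightarrow> finite {x \<in> pos. f x \<in> neg}"
proof (induction f rule: G_word_induct)
  case id
  have "{x \<in> pos. id x \<in> neg} = {}" using pos_not_neg by auto
  then show ?case by (metis finite.emptyI)
next
  case (rfl t f)
  have "{x \<in> pos. (rfl (a t) \<circ> f) x \<in> neg} \<subseteq> insert (fun_inv f (a t)) {x \<in> pos. f x \<in> neg}"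
  proof
    fix x assume x: "x \<in> {x \<in> pos. (rfl (a t) \<circ> f) x \<in> neg}"
    then have "f x \<in> pos \<Longrightarrow> f x = a t"
      using simple_rfl_pos[OF \<open>t \<in> S\<close>] pos_not_neg by auto
    then have "f x \<in> pos \<Longrightarrow> x = fun_inv f (a t)"
      using inv_G_simps[OF \<open>f \<in> G\<close>] by metis
    then show "x \<in> insert (fun_inv f (a t)) {x \<in> pos. f x \<in> neg}"
      using x Phi_pos_or_neg G_Phi[OF \<open>f \<in> G\<close>] pos_Phi by blast
  qed
  then show ?case using rfl finite_subset by blast
qed

section \<open>Dominance\<close>

text \<open>In terms of inverses of group elements, this is the relation \<open>x \<preceq> y\<close> on positive roots.\<close>
definition dominated_by :: "'v \<Rightarrow> 'v \<Rightarrow> bool" where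
  "dominated_by x y \<longleftrightarrow> (\<forall>f\<in>G. f y \<in> neg \<longrightarrow> f x \<in> neg)"

definition depth :: "'v \<Rightarrow> nat" where
  "depth y = card {x \<in> pos. dominated_by x y \<and> x \<noteq> y}"

lemma dominated_by_trans: "dominated_by x y \<Longrightarrow> dominated_by y z \<Longrightarrow> dominated_by x z"
  by (auto simp: dominated_by_def)

lemma dominated_by_image: "h \<in> G \<Longrightarrow> dominated_by x y \<Longrightarrow> dominated_by (h x) (h y)"
  unfolding dominated_by_def using comp_G by (metis comp_apply)

lemma rfl_self_neg: "y \<in> pos \<Longrightarrow> rfl y y \<in> neg"
  by (simp add: rfl_self norm_Phi pos_Phi uminus_neg_iff)

lemma finite_dominated: "y \<in> pos \<Longrightarrow> finite {x \<in> pos. dominated_by x y \<and> x \<noteq> y}"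
proof -
  assume y: "y \<in> pos"
  then have "{x \<in> pos. dominated_by x y \<and> x \<noteq> y} \<subseteq> {x \<in> pos. rfl y x \<in> neg}"
    using rfl_G pos_Phi rfl_self_neg by (auto simp: dominated_by_def)
  then show ?thesis using finite_inversions[OF rfl_G[OF pos_Phi[OF y]]] finite_subset by blast
qed

lemma G_simple:
  assumes "x \<in> Phi" obtains f t where "f \<in> G" "t \<in> S" "f x = a t"
proof -
  obtain g t where "g \<in> G" "t \<in> S" "x = g (a t)" using assms by (rule PhiE)
  then show ?thesis using that[of "fun_inv g" t] inv_G by (simp add: inv_G_simps)
qed

text \<open>Move \<open>x\<close> to a simple root. The only positive root that the simple reflection makes negative is that
  root, and \<open>y\<close> changes sign together with \<open>x\<close>.\<close>
lemma dominated_by_antisym: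
  assumes x: "x \<in> pos" and y: "y \<in> pos" and d: "dominated_by x y" "dominated_by y x"
  shows "x = y"
proof -
  obtain f t where f: "f \<in> G" "t \<in> S" "f x = a t" using G_simple pos_Phi[OF x] by blast
  have "f x \<notin> neg" using simple_pos pos_not_neg f by simp
  then have "f y \<notin> neg" using d(1) f(1) by (auto simp: dominated_by_def)
  then have fy: "f y \<in> pos" using not_pos_iff G_Phi f(1) pos_Phi y by blast
  let ?g = "rfl (a t) \<circ> f"
  have "?g x \<in> neg" using rfl_self_neg[OF simple_pos[OF f(2)]] f(3) by simp
  then have "?g y \<in> neg" using d(2) comp_G[OF rfl_simple_G[OF f(2)] f(1)] unfolding dominated_by_def by blast
  then have "f y = f x" using simple_rfl_pos[OF f(2) fy] pos_not_neg f(3) by auto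
  then show ?thesis using inv_G_simps(2)[OF f(1)] by metis
qed

lemma depth_mono:
  assumes "x \<in> pos" "y \<in> pos" "dominated_by x y"
  shows "depth x \<le> depth y"
proof (cases "x = y")
  case False
  then have "\<not> dominated_by y x" using dominated_by_antisym assms by blast
  then show ?thesis unfolding depth_def using assms dominated_by_trans finite_dominated
    by (intro card_mono) auto
qed simp

text \<open>If \<open>x\<close> is dominated by \<open>y\<close>, then \<open>s\<^sub>y\<close> makes \<open>x\<close> negative, and \<open>y\<close> is dominated by \<open>- s\<^sub>y x\<close>. So dominance
  propagates along a dihedral orbit.\<close>
lemma dominated_by_step:
  assumes x: "x \<in> pos" and y: "y \<in> pos" and d: "dominated_by x y"
  defines "z \<equiv> (2 * B x y) *\<^sub>R y - x"
  shows "z \<in> pos \<and> dominated_by y z \<and> B y z = B x y"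
proof -
  have yP: "y \<in> Phi" and yy: "B y y = 1" using y pos_Phi norm_Phi by auto
  have z: "z = - rfl y x" by (simp add: z_def rfl_eq sym[of y x])
  have "rfl y x \<in> neg" using d rfl_G[OF yP] rfl_self_neg[OF y] by (auto simp: dominated_by_def)
  then have "z \<in> pos" by (simp add: z neg_iff)
  moreover have "dominated_by y z" unfolding dominated_by_def
  proof (intro ballI impI)
    fix f assume f: "f \<in> G" and "f z \<in> neg"
    then have "f (rfl y x) \<notin> neg" using f pos_not_neg by (simp add: z lin_G uminus_neg_iff)
    then have "f (rfl y y) \<notin> neg"
      using d comp_G[OF f rfl_G[OF yP]] by (auto simp: dominated_by_def)
    then have "f (- y) \<in> pos"
      using not_pos_iff[OF G_Phi[OF f uminus_Phi[OF yP]]] by (simp add: rfl_self yy)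
    then show "f y \<in> neg" using f by (simp add: lin_G neg_iff)
  qed
  moreover have "B y z = B x y" by (simp add: z_def form_simps yy sym[of y x])
  ultimately show ?thesis by blast
qed

text \<open>For \<open>c = cos t\<close> the sequence is \<open>sin (k t) / sin t\<close>; choose \<open>k t\<close> between \<open>\<pi>\<close> and \<open>2 \<pi>\<close>.\<close>
lemma cheb_negative:
  assumes "c < 1" shows "\<exists>k. cheb c k < 0"
proof (cases "c < 0")
  case True
  then show ?thesis by (intro exI[of _ 2]) (simp add: numeral_2_eq_2)
next
  case False
  define t where "t = arccos c"
  have t: "0 < t" "t \<le> pi / 2" "cos t = c"
    using False assms arccos_lt_bounded[of c] arccos_le_pi2[of c] by (auto simp: t_def)
  \<comment> \<open>the least \<open>k\<close> with \<open>k t > \<pi>\<close>; since \<open>t \<le> \<pi> / 2\<close>, also \<open>k t < 2 \<pi>\<close>\<close>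
  define k where "k = nat (\<lfloor>pi / t\<rfloor> + 1)"
  have "real k = real_of_int \<lfloor>pi / t\<rfloor> + 1" using t by (simp add: k_def)
  then have "pi / t < real k" "real k \<le> pi / t + 1" by linarith+
  then have "pi < real k * t" "real k * t \<le> pi + t" using t by (simp_all add: field_simps)
  then have "sin (real k * t) < 0" using t by (intro sin_lt_zero) linarith+
  moreover have "0 < sin t" using t by (intro sin_gt_zero) linarith+
  ultimately have "cheb c k < 0" using sin_mult_cheb_cos[of t k] t(3)
    by (metis mult_nonneg_nonneg less_imp_le not_le)
  then show ?thesis by blast
qed

text \<open>Iterating the previous step gives a sequence of positive roots whose coefficients in \<open>x\<close> and \<open>y\<close>
  are Chebyshev numbers at \<open>B x y\<close>. If that were less than one, the numbers would change sign, and at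
  the first change the root would be negative.\<close>
theorem dominated_by_imp_form_ge_1:
  assumes x: "x \<in> pos" and y: "y \<in> pos" and d: "dominated_by x y"
  shows "1 \<le> B x y"
proof (rule ccontr)
  define c where "c = B x y"
  assume "\<not> ?thesis"
  then have "c < 1" by (simp add: c_def)
  define r where "r k = cheb c (Suc k) *\<^sub>R y - cheb c k *\<^sub>R x" for k
  have r: "r k \<in> pos \<and> r (Suc k) \<in> pos \<and> dominated_by (r k) (r (Suc k)) \<and> B (r k) (r (Suc k)) = c" for k
  proof (induction k)
    case 0
    show ?case using dominated_by_step[OF x y d] y by (simp add: r_def c_def)
  next
    case (Suc k)
    have "(2 * c) *\<^sub>R r (Suc k) - r k = r (Suc (Suc k))" by (simp add: r_def algebra_simps)
    then show ?case using Suc dominated_by_step[of "r k" "r (Suc k)"] by simp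
  qed
  define k where "k = (LEAST k. cheb c k < 0)"
  have k: "cheb c k < 0" unfolding k_def by (rule LeastI_ex[OF cheb_negative[OF \<open>c < 1\<close>]])
  then obtain j where j: "k = Suc j" by (cases k) auto
  have "\<not> cheb c j < 0" using not_less_Least[of j "\<lambda>k. cheb c k < 0"] j by (simp add: k_def)
  moreover have "- r j = (- cheb c k) *\<^sub>R y + cheb c j *\<^sub>R x" by (simp add: r_def j)
  ultimately have "- r j \<in> cone"
    using k cone_add[OF cone_scale[OF _ pos_cone[OF y], of "- cheb c k"]
        cone_scale[OF _ pos_cone[OF x], of "cheb c j"]] by simp
  then show False using r[of j] cone_salient pos_cone nonzero_Phi pos_Phi by blast
qed

text \<open>Suppose that \<open>f\<close> makes \<open>y\<close> negative but not \<open>x\<close>. The roots \<open>u = f x\<close> and \<open>v = - f y\<close> are positive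
  with \<open>B u v \<le> -1\<close>, so they generate infinitely many positive roots \<open>p u + q v\<close> with \<open>p, q \<ge> 0\<close>. The inverse of
  \<open>f\<close> maps them to \<open>p x - q y\<close>, which is negative by hypothesis when \<open>q > 0\<close>; but an inversion set is finite.\<close>
theorem form_ge_1_imp_dominated_by:
  assumes x: "x \<in> pos" and y: "y \<in> pos" and xy: "1 \<le> B x y"
    and extremal_in: "\<And>p q. 0 \<le> p \<Longrightarrow> 0 < q \<Longrightarrow> p *\<^sub>R x - q *\<^sub>R y \<notin> pos"
  shows "dominated_by x y"
  unfolding dominated_by_def
proof (intro ballI impI, rule ccontr)
  fix f assume f: "f \<in> G" and fy: "f y \<in> neg" and "f x \<notin> neg"
  define u v where "u = f x" and "v = - f y"
  have u: "u \<in> pos" using \<open>f x \<notin> neg\<close> not_pos_iff G_Phi[OF f] pos_Phi[OF x] by (auto simp: u_def)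
  have v: "v \<in> pos" using fy by (simp add: v_def neg_iff)
  define c where "c = - B u v"
  have c: "1 \<le> c" using xy by (simp add: c_def u_def v_def form_simps isometry_G[OF f])
  note mono = cheb_strict_mono[OF c]
  have sm: "strict_mono (cheb c)" using mono by (simp add: strict_mono_Suc_iff)
  define r where "r k = cheb c (Suc (2 * k)) *\<^sub>R u + cheb c (2 * k) *\<^sub>R v" for k
  have r_pos: "r k \<in> pos" for k
  proof -
    have "(rfl u \<circ> rfl v) ^^ k \<in> G" for k
      by (induction k) (simp_all only: funpow.simps id_G comp_G rfl_G pos_Phi u v)
    then have "((rfl u \<circ> rfl v) ^^ k) u \<in> Phi" using G_Phi u pos_Phi by blast
    then have "r k \<in> Phi" using rotation_power[of u v k] norm_Phi u v pos_Phi by (simp add: r_def c_def)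
    then show ?thesis using pos_combination[OF _ u v] mono by (simp add: r_def)
  qed
  have "r (Suc k) \<in> {z \<in> pos. fun_inv f z \<in> neg}" for k
  proof -
    have "f (cheb c (Suc (2 * Suc k)) *\<^sub>R x - cheb c (2 * Suc k) *\<^sub>R y) = r (Suc k)"
      by (simp add: r_def lin_G[OF f] u_def v_def del: cheb.simps)
    then have "fun_inv f (r (Suc k)) = cheb c (Suc (2 * Suc k)) *\<^sub>R x - cheb c (2 * Suc k) *\<^sub>R y"
      using inv_G_simps[OF f] by metis
    moreover have "0 < cheb c (2 * Suc k)" using strict_monoD[OF sm, of 0 "2 * Suc k"] by simp
    ultimately have "fun_inv f (r (Suc k)) \<notin> pos" using extremal_in mono by (simp del: cheb.simps mult_Suc_right)
    then show ?thesis using r_pos not_pos_iff G_Phi[OF inv_G[OF f]] pos_Phi by blast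
  qed
  then have "range (\<lambda>k. r (Suc k)) \<subseteq> {z \<in> pos. fun_inv f z \<in> neg}" by blast
  then have "finite (range (\<lambda>k. r (Suc k)))" using finite_inversions[OF inv_G[OF f]] finite_subset by blast
  moreover have "inj (\<lambda>k. r (Suc k))"
  proof (rule linorder_injI)
    fix i j :: nat assume "i < j"
    let ?p = "cheb c (Suc (2 * Suc j)) - cheb c (Suc (2 * Suc i))"
    let ?q = "cheb c (2 * Suc j) - cheb c (2 * Suc i)"
    have pq: "0 < ?p" "0 < ?q"
      using strict_monoD[OF sm, of "Suc (2 * Suc i)" "Suc (2 * Suc j)"]
        strict_monoD[OF sm, of "2 * Suc i" "2 * Suc j"] \<open>i < j\<close> by auto
    show "r (Suc i) \<noteq> r (Suc j)"
    proof
      assume "r (Suc i) = r (Suc j)"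
      then have "- (?p *\<^sub>R u) = ?q *\<^sub>R v" by (simp add: r_def algebra_simps del: cheb.simps)
      moreover have "?p *\<^sub>R u \<in> cone" "?q *\<^sub>R v \<in> cone" using pq u v cone_scale pos_cone by auto
      ultimately have "?p *\<^sub>R u = 0" using cone_salient by metis
      then show False using pq nonzero_Phi[OF pos_Phi[OF u]] by simp
    qed
  qed
  ultimately show False using finite_imageD infinite_UNIV_nat by blast
qed

corollary simple_dominated_by_iff:
  assumes "t \<in> S" "y \<in> pos" "y \<noteq> a t"
  shows "dominated_by (a t) y \<longleftrightarrow> 1 \<le> B (a t) y"
proof
  assume "1 \<le> B (a t) y"
  then show "dominated_by (a t) y"
  proof (rule form_ge_1_imp_dominated_by[OF simple_pos[OF assms(1)] assms(2)])
    fix p q :: real assume "0 < q"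
    show "p *\<^sub>R a t - q *\<^sub>R y \<notin> pos"
      using simple_extremal_pos[OF assms(1,2) _ \<open>0 < q\<close>, of "p *\<^sub>R a t - q *\<^sub>R y" p] assms(3) pos_cone by auto
  qed
qed (use dominated_by_imp_form_ge_1 assms simple_pos in blast)

end

section \<open>Depth under reflections\<close>

text \<open>The change of the \<open>\<infinity>\<close>-depth of a root under a simple reflection, as a function of the product of
  the root with the simple root.\<close>
definition depth_step :: "real \<Rightarrow> int" where
  "depth_step x = (if x \<le> -1 then 1 else if 1 \<le> x then -1 else 0)"

lemma depth_step_antimono: "x \<le> y \<Longrightarrow> depth_step y \<le> depth_step x"
  and depth_step_uminus: "depth_step (- x) = - depth_step x"
  by (auto simp: depth_step_def)

context root_basis begin

text \<open>The extension of the \<open>\<infinity>\<close>-depth to all roots for which the rule for simple reflections has no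
  exceptions: the shift by one matches the jump from \<open>a t\<close> to \<open>- a t\<close>, where the form has the value \<open>1\<close>.\<close>
definition signed_depth :: "'v \<Rightarrow> int" where
  "signed_depth x = (if x \<in> pos then int (depth x) else - int (depth (- x)) - 1)"

lemma depth_simple: "t \<in> S \<Longrightarrow> depth (a t) = 0"
proof -
  assume t: "t \<in> S"
  have "x = a t" if "x \<in> pos" "dominated_by x (a t)" for x
  proof (rule ccontr)
    assume "x \<noteq> a t"
    then have "rfl (a t) x \<in> pos" using simple_rfl_pos t that by blast
    moreover have "rfl (a t) x \<in> neg"
      using that(2) rfl_simple_G[OF t] rfl_self_neg[OF simple_pos[OF t]] unfolding dominated_by_def by blast
    ultimately show False using pos_not_neg by blast
  qed
  then have "{x \<in> pos. dominated_by x (a t) \<and> x \<noteq> a t} = {}" by blast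
  then show ?thesis unfolding depth_def by (metis card.empty)
qed

lemma depth_split:
  assumes t: "t \<in> S" and x: "x \<in> pos" "x \<noteq> a t"
  shows "depth x = card ({z \<in> pos. dominated_by z x \<and> z \<noteq> x} - {a t}) + (if 1 \<le> B (a t) x then 1 else 0)"
proof -
  let ?X = "{z \<in> pos. dominated_by z x \<and> z \<noteq> x}"
  have mem: "a t \<in> ?X \<longleftrightarrow> 1 \<le> B (a t) x"
    using simple_dominated_by_iff[OF assms] simple_pos[OF t] x(2) by auto
  show ?thesis
  proof (cases "1 \<le> B (a t) x")
    case True
    then have "card ?X = Suc (card (?X - {a t}))"
      using mem finite_dominated[OF x(1)] by (intro card.remove) auto
    then show ?thesis using True by (simp add: depth_def)
  next
    case False
    then have "?X - {a t} = ?X" using mem by blast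
    then show ?thesis using False by (simp add: depth_def)
  qed
qed

text \<open>A simple reflection is a bijection between the roots dominated by \<open>x\<close> and by its image, except for
  the simple root itself, and whether that one is dominated is read off from the form.\<close>
lemma depth_rfl_simple:
  assumes t: "t \<in> S" and x: "x \<in> pos" "x \<noteq> a t"
  shows "int (depth (rfl (a t) x)) = int (depth x) + depth_step (B (a t) x)"
proof -
  define s where "s = rfl (a t)"
  have s: "s \<in> G" "\<And>v. s (s v) = v" using t by (simp_all add: s_def rfl_simple_G rfl_rfl norm1)
  have s_pos: "s z \<in> pos \<and> s z \<noteq> a t" if "z \<in> pos" "z \<noteq> a t" for z
  proof -
    have p: "s z \<in> pos" using simple_rfl_pos t that by (simp add: s_def)
    have "s (a t) \<in> neg" using rfl_self_neg simple_pos t by (simp add: s_def)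
    then show ?thesis using p s(2)[of z] that pos_not_neg by metis
  qed
  \<comment> \<open>the simple root is removed because the reflection makes it negative\<close>
  let ?X = "\<lambda>x. {z \<in> pos. dominated_by z x \<and> z \<noteq> x} - {a t}"
  have dominated_by_s: "dominated_by z y \<Longrightarrow> dominated_by (s z) (s y)" for z y using dominated_by_image s(1) by blast
  have sub: "s ` ?X y \<subseteq> ?X (s y)" if "y \<in> pos" "y \<noteq> a t" for y
    using s_pos dominated_by_s s(2) by (auto, metis)
  have X_eq: "s ` ?X x = ?X (s x)"
  proof
    show "s ` ?X x \<subseteq> ?X (s x)" using sub x by blast
    have "s ` ?X (s x) \<subseteq> ?X (s (s x))" by (rule sub) (use s_pos[OF x] in blast)+
    then have s_back: "s z \<in> ?X x" if "z \<in> ?X (s x)" for z using that unfolding s(2) by blast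
    show "?X (s x) \<subseteq> s ` ?X x"
    proof
      fix z assume "z \<in> ?X (s x)"
      then have "s z \<in> ?X x" by (rule s_back)
      then show "z \<in> s ` ?X x" by (rule rev_image_eqI) (simp add: s(2))
    qed
  qed
  have "inj_on s (?X x)" by (rule inj_on_inverseI) (rule s(2))
  then have "card (?X (s x)) = card (?X x)" unfolding X_eq[symmetric] by (rule card_image)
  moreover have "B (a t) (s x) = - B (a t) x"
    by (simp add: s_def rfl_eq form_simps norm1 t)
  ultimately show ?thesis
    using depth_split[OF t x] depth_split[OF t, of "s x"] s_pos[OF x]
    by (auto simp: s_def[symmetric] depth_step_def)
qed

lemma signed_depth_rfl_simple:
  assumes t: "t \<in> S" and x: "x \<in> Phi"
  shows "signed_depth (rfl (a t) x) = signed_depth x + depth_step (B (a t) x)"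
proof -
  have *: "signed_depth (rfl (a t) y) = signed_depth y + depth_step (B (a t) y) \<and>
      signed_depth (- rfl (a t) y) = signed_depth (- y) + depth_step (B (a t) (- y))" if y: "y \<in> pos" for y
  proof (cases "y = a t")
    case True
    have "- a t \<notin> pos" using pos_not_neg[OF y] True by (simp add: neg_iff)
    then show ?thesis using True t
      by (simp add: rfl_self norm1 signed_depth_def simple_pos depth_simple depth_step_def form_simps)
  next
    case False
    let ?z = "rfl (a t) y"
    have z: "?z \<in> pos" using simple_rfl_pos t y False by blast
    have "- y \<notin> pos" "- ?z \<notin> pos" using pos_not_neg y z by (auto simp: neg_iff)
    then show ?thesis using depth_rfl_simple[OF t y False] y z
      by (simp add: signed_depth_def form_simps depth_step_uminus)
  qed
  show ?thesis
  proof (cases "x \<in> pos")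
    case False
    then have "- x \<in> pos" using not_pos_iff x by (simp add: neg_iff)
    moreover have "rfl (a t) (- x) = - rfl (a t) x" by (simp add: linear_neg[OF linear_rfl])
    ultimately show ?thesis using *[of "- x"] by simp
  qed (use * in blast)
qed

text \<open>Along a word for \<open>f\<close>, each letter \<open>t\<close> contributes the value of \<open>depth_step\<close> at \<open>B e x\<close>, where \<open>e\<close> is the
  root that the preceding part of the word maps to \<open>a t\<close>. If \<open>e\<close> is positive it is a new inversion; otherwise
  \<open>- e\<close> ceases to be one, and oddness of \<open>depth_step\<close> makes the two contributions cancel.\<close>
theorem signed_depth_image:
  assumes "f \<in> G" "x \<in> Phi"
  shows "signed_depth (f x) = signed_depth x + (\<Sum>z\<in>{z \<in> pos. f z \<in> neg}. depth_step (B z x))"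
  using assms
proof (induction f rule: G_word_induct)
  case id
  have "{z \<in> pos. id z \<in> neg} = {}" using pos_not_neg by auto
  then show ?case by (metis (no_types, lifting) add.right_neutral id_apply sum.empty)
next
  case (rfl t f)
  note t = \<open>t \<in> S\<close> and f = \<open>f \<in> G\<close>
  define N N' where N_def: "N = {z \<in> pos. f z \<in> neg}"
    and N'_def: "N' = {z \<in> pos. (rfl (a t) \<circ> f) z \<in> neg}"
  define e where "e = fun_inv f (a t)"
  have fe: "f e = a t" by (simp add: e_def inv_G_simps f)
  have f_eq: "f z = f w \<longleftrightarrow> z = w" for z w using inv_G_simps(2)[OF f] by metis
  have e: "e \<in> Phi" unfolding e_def using G_Phi inv_G f simple_Phi t by blast
  have fin: "finite N" unfolding N_def by (rule finite_inversions[OF f])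
  have Be: "B e x = B (a t) (f x)" using isometry_G[OF f, of e x] fe by simp
  \<comment> \<open>composing with \<open>s\<^sub>t\<close> changes the sign only at the roots that \<open>f\<close> maps to \<open>\<plusminus> a t\<close>\<close>
  have other: "z \<in> N' \<longleftrightarrow> z \<in> N" if "z \<noteq> e" "z \<noteq> - e" for z
  proof (cases "z \<in> pos")
    case True
    have fz: "f z \<noteq> a t" "- f z \<noteq> a t"
      using that f_eq[of z e] f_eq[of "- z" e] fe linear_neg[OF linear_G[OF f], of z] by auto
    show ?thesis
    proof (cases "f z \<in> pos")
      case True
      then show ?thesis using simple_rfl_pos[OF t True] fz pos_not_neg by (auto simp: N_def N'_def)
    next
      case False
      then have "- f z \<in> pos" using not_pos_iff G_Phi[OF f] pos_Phi \<open>z \<in> pos\<close> by (simp add: neg_iff)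
      then have "rfl (a t) (- f z) \<in> pos" using simple_rfl_pos[OF t] fz by blast
      then show ?thesis using \<open>- f z \<in> pos\<close> \<open>z \<in> pos\<close>
        by (simp add: neg_iff linear_neg[OF linear_rfl] N_def N'_def)
    qed
  qed (simp add: N_def N'_def)
  have "(\<Sum>z\<in>N'. depth_step (B z x)) = (\<Sum>z\<in>N. depth_step (B z x)) + depth_step (B e x)"
  proof (cases "e \<in> pos")
    case True
    have "e \<notin> N" "- e \<notin> N" "- e \<notin> N'" "e \<in> N'"
      using fe simple_pos[OF t] pos_not_neg True rfl_self_neg[OF simple_pos[OF t]]
      by (auto simp: neg_iff N_def N'_def)
    then have "z \<in> N' \<longleftrightarrow> z \<in> insert e N" for z
      using other[of z] by (cases "z = - e"; cases "z = e") auto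
    then have "N' = insert e N" by blast
    then show ?thesis using sum.insert[OF fin \<open>e \<notin> N\<close>] by (simp add: add.commute)
  next
    case False
    then have me: "- e \<in> pos" using not_pos_iff e by (simp add: neg_iff)
    have fme: "f (- e) = - a t" using fe f by (simp add: lin_G)
    have eN: "- e \<in> N" using me fme simple_pos[OF t] by (simp add: uminus_neg_iff N_def)
    have "- e \<notin> N'" using fme simple_pos[OF t] pos_not_neg
      by (simp add: linear_neg[OF linear_rfl] rfl_self norm1 t N'_def)
    moreover have "e \<notin> N" "e \<notin> N'" using False by (simp_all add: N_def N'_def)
    ultimately have "z \<in> N' \<longleftrightarrow> z \<in> N - {- e}" for z
      using other[of z] by (cases "z = - e"; cases "z = e") auto
    then have "N' = N - {- e}" by blast
    then have "(\<Sum>z\<in>N'. depth_step (B z x)) = (\<Sum>z\<in>N. depth_step (B z x)) - depth_step (B (- e) x)"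
      using sum_diff1[OF fin, of "\<lambda>z. depth_step (B z x)" "- e"] eN by simp
    then show ?thesis by (simp add: form_simps depth_step_uminus)
  qed
  then show ?case using signed_depth_rfl_simple[OF t G_Phi[OF f \<open>x \<in> Phi\<close>]] rfl Be
    by (simp add: N_def N'_def)
qed

text \<open>The involution \<open>z \<mapsto> - s\<^sub>x z\<close> permutes the inversions of \<open>s\<^sub>x\<close>, and \<open>B x z > 0\<close> for each of them, so
  \<open>B (- s\<^sub>x z) y = - B z y + 2 B x z B x y \<le> - B z y\<close>. As \<open>depth_step\<close> is odd and antitone, the terms of the sum for
  \<open>z\<close> and \<open>- s\<^sub>x z\<close> add up to a nonnegative number.\<close>
theorem depth_le_depth_rfl:
  assumes x: "x \<in> pos" and y: "y \<in> pos" and xy: "B x y \<le> 0"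
  shows "depth y \<le> depth (rfl x y)"
proof -
  let ?N = "{z \<in> pos. rfl x z \<in> neg}"
  define i where "i z = - rfl x z" for z
  have xP: "x \<in> Phi" "B x x = 1" using x pos_Phi norm_Phi by auto
  have ii: "i (i z) = z" for z
    by (simp add: i_def linear_neg[OF linear_rfl] rfl_rfl xP)
  have iN: "i z \<in> ?N" if "z \<in> ?N" for z
  proof -
    have "i z \<in> pos" using that by (simp add: i_def neg_iff)
    moreover have "rfl x (i z) = - z" by (simp add: i_def linear_neg[OF linear_rfl] rfl_rfl xP)
    ultimately show ?thesis using that by (simp add: uminus_neg_iff)
  qed
  have bij: "bij_betw i ?N ?N"
    by (rule bij_betw_byWitness[of _ i]) (use ii iN in auto)
  have ge: "- depth_step (B z y) \<le> depth_step (B (i z) y)" if z: "z \<in> ?N" for z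
  proof -
    have "0 < B x z"
    proof (rule ccontr)
      assume "\<not> ?thesis"
      then have "rfl x z \<in> pos"
        using pos_combination[of "rfl x z" z x 1 "- 2 * B x z"] z x rfl_Phi pos_Phi
        by (simp add: rfl_eq)
      then show False using z pos_not_neg by auto
    qed
    then have "B x z * B x y \<le> 0" using xy by (simp add: mult_nonneg_nonpos)
    moreover have "B (i z) y = - B z y + 2 * (B x z * B x y)" by (simp add: i_def rfl_eq form_simps)
    ultimately have "B (i z) y \<le> - B z y" by linarith
    then show ?thesis using depth_step_antimono depth_step_uminus by metis
  qed
  have "- (\<Sum>z\<in>?N. depth_step (B z y)) \<le> (\<Sum>z\<in>?N. depth_step (B (i z) y))"
    unfolding sum_negf[symmetric] using ge by (rule sum_mono)
  also have "\<dots> = (\<Sum>z\<in>?N. depth_step (B z y))"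
    using sum.reindex_bij_betw[OF bij, of "\<lambda>z. depth_step (B z y)"] by simp
  finally have "signed_depth y \<le> signed_depth (rfl x y)"
    using signed_depth_image[OF rfl_G[OF xP(1)] pos_Phi[OF y]] by linarith
  moreover have "rfl x y \<in> pos"
    using pos_combination[of "rfl x y" y x 1 "- 2 * B x y"] x y xy rfl_Phi pos_Phi
    by (simp add: rfl_eq)
  ultimately show ?thesis using y by (simp add: signed_depth_def)
qed

section \<open>Roots in a plane\<close>

definition extremal_in :: "'v set \<Rightarrow> 'v \<Rightarrow> bool" where
  "extremal_in P x \<longleftrightarrow> x \<in> P \<inter> pos \<and>
     (\<forall>y\<in>P \<inter> pos. \<forall>z\<in>P \<inter> pos. \<forall>p>0. \<forall>q>0. x = p *\<^sub>R y + q *\<^sub>R z \<longrightarrow> y = x \<and> z = x)"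

lemma extremal_in_simple:
  assumes "t \<in> S" "a t \<in> P"
  shows "extremal_in P (a t)"
  unfolding extremal_in_def
proof (intro conjI IntI ballI allI impI)
  fix y z and p q :: real
  assume y: "y \<in> P \<inter> pos" and z: "z \<in> P \<inter> pos" and pq: "0 < p" "0 < q"
    and e: "a t = p *\<^sub>R y + q *\<^sub>R z"
  show "y = a t" using simple_extremal_pos[of t y "q *\<^sub>R z" p 1] assms(1) y z pq e cone_scale pos_cone by simp
  show "z = a t" using simple_extremal_pos[of t z "p *\<^sub>R y" q 1] assms(1) y z pq e cone_scale pos_cone
    by (simp add: add.commute)
qed (use assms simple_pos in auto)

lemma extremal_in_rfl_simple:
  assumes t: "t \<in> S" and P: "subspace P" "a t \<notin> P" and x: "extremal_in (rfl (a t) ` P) x"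
  shows "extremal_in P (rfl (a t) x)"
proof -
  let ?s = "rfl (a t)"
  have ss: "?s (?s v) = v" for v using rfl_rfl norm1 t by blast
  have sx: "?s v \<in> P \<longleftrightarrow> v \<in> ?s ` P" for v using ss by (metis imageE imageI)
  have at: "a t \<notin> ?s ` P"
  proof
    assume "a t \<in> ?s ` P"
    then have "- a t \<in> P" using sx[of "a t"] rfl_self norm1 t by simp
    then show False using P subspace_neg[of P "- a t"] by simp
  qed
  have s_pos: "?s y \<in> (?s ` P) \<inter> pos" if "y \<in> P \<inter> pos" for y
    using that P simple_rfl_pos[OF t, of y] by auto
  have x': "x \<in> ?s ` P" "x \<in> pos" using x by (auto simp: extremal_in_def)
  then have "x \<noteq> a t" using at by metis
  then have "?s x \<in> P \<inter> pos" using sx simple_rfl_pos[OF t] x' by blast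
  moreover have "y = ?s x \<and> z = ?s x"
    if yz: "y \<in> P \<inter> pos" "z \<in> P \<inter> pos" "0 < p" "0 < q" "?s x = p *\<^sub>R y + q *\<^sub>R z" for y z p q
  proof -
    have "x = p *\<^sub>R ?s y + q *\<^sub>R ?s z"
      using arg_cong[OF yz(5), of ?s] by (simp add: ss linear_add[OF linear_rfl] linear_scale[OF linear_rfl])
    then have "?s y = x \<and> ?s z = x" using x s_pos yz unfolding extremal_in_def by blast
    then show ?thesis using ss by metis
  qed
  ultimately show ?thesis unfolding extremal_in_def by blast
qed

lemma subspace_rfl: "subspace P \<Longrightarrow> subspace (rfl b ` P)"
  by (rule linear_subspace_image[OF linear_rfl])

text \<open>Induction on \<open>y\<close>. A simple root in \<open>P\<close> is extremal. A simple reflection whose root is not in \<open>P\<close> maps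
  the positive roots of \<open>P\<close> to those of the reflected plane, so extremal roots can be carried back from there. If
  the root of the reflection is in \<open>P\<close>, it is the required one unless it is \<open>x\<close>, and then the
  reflection preserves \<open>P\<close> and simplifies \<open>y\<close>. Avoiding \<open>x\<close> allows a second use that gives the
  other extremal root.\<close>
lemma extremal_in_exists:
  assumes "y \<in> pos" "subspace P" "y \<in> P" "x \<in> P \<inter> pos" "x \<noteq> y"
  shows "\<exists>z. extremal_in P z \<and> z \<noteq> x"
  using assms
proof (induction y arbitrary: P x rule: pos_root_induct)
  case (simple s)
  then show ?case using extremal_in_simple by blast
next
  case (rfl t y)
  let ?s = "rfl (a t)"
  have ss: "?s (?s v) = v" for v using rfl_rfl norm1 rfl by blast
  have sy: "y \<in> ?s ` P" using rfl.prems ss by (metis imageI)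
  show ?case
  proof (cases "a t \<in> P")
    case True
    show ?thesis
    proof (cases "x = a t")
      case True
      have "y = ?s y + (2 * B (a t) y) *\<^sub>R a t" by (simp add: rfl_eq)
      then have "y \<in> P" using \<open>a t \<in> P\<close> rfl.prems by (metis subspace_add subspace_scale)
      then show ?thesis using rfl True by blast
    qed (use extremal_in_simple True rfl in blast)
  next
    case False
    have "x \<noteq> a t" using False rfl.prems by blast
    then have "?s x \<in> ?s ` P \<inter> pos" using simple_rfl_pos rfl by blast
    moreover have "?s x \<noteq> y" using rfl.prems ss by metis
    ultimately obtain z where z: "extremal_in (?s ` P) z" "z \<noteq> ?s x"
      using rfl.IH[OF subspace_rfl[OF rfl.prems(1)] sy] by blast
    then have "extremal_in P (?s z)" using extremal_in_rfl_simple rfl False by blast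
    moreover have "?s z \<noteq> x" using z ss by metis
    ultimately show ?thesis by blast
  qed
qed

text \<open>The pair is the canonical simple system of the dihedral group of the plane, described by
  cones instead of inversion sets.\<close>
definition dihedral_basis :: "'v set \<Rightarrow> 'v \<Rightarrow> 'v \<Rightarrow> bool" where
  "dihedral_basis P x y \<longleftrightarrow> subspace P \<and> x \<in> P \<inter> pos \<and> y \<in> P \<inter> pos \<and> x \<noteq> y \<and>
     (\<forall>z\<in>P \<inter> pos. \<exists>p q. 0 \<le> p \<and> 0 \<le> q \<and> z = p *\<^sub>R x + q *\<^sub>R y)"

lemma dihedral_basis_sym: "dihedral_basis P x y \<Longrightarrow> dihedral_basis P y x"
  unfolding dihedral_basis_def by (metis add.commute)

lemma pos_independent:
  assumes "x \<in> pos" "y \<in> pos" "x \<noteq> y" "p *\<^sub>R x + q *\<^sub>R y = 0"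
  shows "p = 0 \<and> q = 0"
proof (cases "p = 0")
  case True
  then show ?thesis using assms nonzero_Phi pos_Phi by fastforce
next
  case False
  have "p *\<^sub>R x = (- q) *\<^sub>R y" using assms(4) by (simp add: eq_neg_iff_add_eq_0)
  then have "x = (- q / p) *\<^sub>R y" using False
    by (metis divide_inverse_commute scaleR_one scaleR_scaleR left_inverse)
  then show ?thesis using pos_multiple assms by blast
qed

text \<open>Two distinct extremal roots are a basis of the plane. If a positive root had a negative
  coefficient, then one of the two would be a positive combination of that root and the other one.\<close>
lemma dihedral_basis_exists:
  assumes P: "subspace P" "dim P = 2" and xy: "x \<in> P \<inter> pos" "y \<in> P \<inter> pos" "x \<noteq> y"
  shows "\<exists>x y. dihedral_basis P x y"
proof -
  obtain u where u: "extremal_in P u" using extremal_in_exists[of y P x] xy P by blast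
  then have "u \<in> P \<inter> pos" by (simp add: extremal_in_def)
  then obtain v where v: "extremal_in P v" "v \<noteq> u"
    using extremal_in_exists[of y P u] extremal_in_exists[of x P u] xy P by blast
  have uv: "u \<in> P" "v \<in> P" "u \<in> pos" "v \<in> pos" using u v by (auto simp: extremal_in_def)
  have "independent {u, v}"
  proof (rule independent_if_scalars_zero)
    fix f z assume "(\<Sum>z\<in>{u, v}. f z *\<^sub>R z) = 0" "z \<in> {u, v}"
    then show "f z = 0" using pos_independent[of u v "f u" "f v"] uv v by auto
  qed simp
  note ind = this
  obtain Bs where Bs: "Bs \<subseteq> P" "independent Bs" "P \<subseteq> span Bs" "card Bs = 2"
    using basis_exists[of P] P(2) by metis
  have "P \<subseteq> span {u, v}"
  proof
    fix w assume w: "w \<in> P"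
    show "w \<in> span {u, v}"
    proof (rule ccontr)
      assume nw: "w \<notin> span {u, v}"
      then have "w \<notin> {u, v}" using span_base[of w "{u, v}"] by blast
      moreover have "independent (insert w {u, v})" by (rule independent_insertI[OF nw ind])
      moreover have "insert w {u, v} \<subseteq> span Bs" using w uv Bs by blast
      ultimately show False
        using independent_span_bound[of Bs "insert w {u, v}"] Bs(4) v(2)
        by (auto simp: card_ge_0_finite)
    qed
  qed
  have "\<exists>p q. 0 \<le> p \<and> 0 \<le> q \<and> z = p *\<^sub>R u + q *\<^sub>R v" if z: "z \<in> P \<inter> pos" for z
  proof -
    obtain p where "z - p *\<^sub>R u \<in> span {v}"
      using \<open>P \<subseteq> span {u, v}\<close> z span_breakdown_eq[of z u "{v}"] by blast
    then obtain q where "z - p *\<^sub>R u = q *\<^sub>R v" by (auto simp: span_singleton)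
    then have e: "z = p *\<^sub>R u + q *\<^sub>R v" by (simp add: algebra_simps)
    have ext1: "0 \<le> p" if ext: "extremal_in P v'" "extremal_in P u'" "u' \<noteq> v'" and e: "z = p *\<^sub>R u' + q *\<^sub>R v'" for u' v' p q
    proof (rule ccontr)
      assume "\<not> 0 \<le> p"
      then have p: "0 < - p" by simp
      have uv': "u' \<in> P \<inter> pos" "v' \<in> P \<inter> pos" using ext by (auto simp: extremal_in_def)
      have qv: "q *\<^sub>R v' = 1 *\<^sub>R z + (- p) *\<^sub>R u'" using e by simp
      have "0 < q"
      proof (rule ccontr)
        assume "\<not> 0 < q"
        then have "- z \<in> cone"
          using cone_add[OF cone_scale[of "- p" u'] cone_scale[of "- q" v']] p uv' pos_cone e by auto
        then show False using cone_salient[of z] z nonzero_Phi pos_Phi pos_cone by blast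
      qed
      have "v' = (1 / q) *\<^sub>R (q *\<^sub>R v')" using \<open>0 < q\<close> by simp
      also have "\<dots> = (1 / q) *\<^sub>R z + (- p / q) *\<^sub>R u'"
        unfolding qv scaleR_right_distrib by simp
      finally have "v' = (1 / q) *\<^sub>R z + (- p / q) *\<^sub>R u'" .
      moreover have "0 < 1 / q" "0 < - p / q" using p \<open>0 < q\<close> by (auto simp: divide_neg_pos)
      ultimately show False using ext z uv' unfolding extremal_in_def by blast
    qed
    have "0 \<le> p" "0 \<le> q"
      using ext1[OF v(1) u _ e] ext1[OF u v(1) _, of q p] e v(2) by (auto simp: add.commute)
    then show ?thesis using e by blast
  qed
  then show ?thesis using uv v(2) P unfolding dihedral_basis_def by blast
qed

context
  fixes P x y assumes xy: "dihedral_basis P x y"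
begin

lemma basis_pos: "x \<in> pos" "y \<in> pos" "x \<in> P" "y \<in> P" "x \<noteq> y" "subspace P"
  using xy by (auto simp: dihedral_basis_def)

lemma basis_Phi: "x \<in> Phi" "y \<in> Phi"
  using basis_pos pos_Phi by auto

lemma basis_norm: "B x x = 1" "B y y = 1"
  using basis_Phi norm_Phi by auto

lemma basis_coords:
  assumes "z \<in> P" "z \<in> pos" obtains p q where "0 \<le> p" "0 \<le> q" "z = p *\<^sub>R x + q *\<^sub>R y"
  using xy assms unfolding dihedral_basis_def by blast

lemma basis_unique:
  assumes "p *\<^sub>R x + q *\<^sub>R y = p' *\<^sub>R x + q' *\<^sub>R y" shows "p = p'" "q = q'"
  using pos_independent[OF basis_pos(1,2,5), of "p - p'" "q - q'"] assms
  by (simp_all add: algebra_simps)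

lemma basis_coords_nonneg:
  assumes "p *\<^sub>R x + q *\<^sub>R y \<in> pos" shows "0 \<le> p" "0 \<le> q"
proof -
  have "p *\<^sub>R x + q *\<^sub>R y \<in> P" using basis_pos by (simp add: subspace_add subspace_scale)
  then show "0 \<le> p" "0 \<le> q" using assms basis_unique by (metis basis_coords)+
qed

text \<open>A root of the plane has coefficients of one sign, so one positive coefficient decides.\<close>
lemma basis_pos_of_snd_pos:
  assumes "p *\<^sub>R x + q *\<^sub>R y \<in> Phi" "0 < q"
  shows "p *\<^sub>R x + q *\<^sub>R y \<in> pos"
proof (rule ccontr)
  assume "\<not> ?thesis"
  then have "(- p) *\<^sub>R x + (- q) *\<^sub>R y \<in> pos" using assms not_pos_iff by (simp add: neg_iff)
  then show False using basis_coords_nonneg(2) assms by fastforce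
qed

lemma rfl_plane: "z \<in> P \<Longrightarrow> w \<in> P \<Longrightarrow> rfl w z \<in> P"
  using basis_pos by (simp add: rfl_eq subspace_diff subspace_scale)

lemma rfl_basis_pos:
  assumes "z \<in> P" "z \<in> pos" "z \<noteq> x"
  shows "rfl x z \<in> pos"
proof -
  obtain p q where pq: "0 \<le> p" "0 \<le> q" "z = p *\<^sub>R x + q *\<^sub>R y" using assms by (metis basis_coords)
  have "q \<noteq> 0" using pos_multiple[of z x p] pq assms basis_pos by auto
  then have "0 < q" using pq by simp
  moreover have "rfl x z = (2 * (- B x y) * q - p) *\<^sub>R x + q *\<^sub>R y"
    unfolding pq(3) by (rule rfl_fst_pair[OF basis_norm(1)])
  moreover have "rfl x z \<in> Phi" using rfl_Phi basis_Phi assms pos_Phi by blast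
  ultimately show ?thesis using basis_pos_of_snd_pos by simp
qed

lemma form_basis_nonpos: "B x y \<le> 0"
proof -
  have "rfl x y \<in> pos" using rfl_basis_pos basis_pos by blast
  moreover have "rfl x y = (- 2 * B x y) *\<^sub>R x + 1 *\<^sub>R y" by (simp add: rfl_eq)
  ultimately show ?thesis using basis_coords_nonneg(1)[of "- 2 * B x y" 1] by simp
qed

text \<open>This settles infinite dihedral groups: \<open>p x - q (s\<^sub>x y)\<close> has coefficient \<open>- q\<close> at \<open>y\<close>, so it is not
  a positive root for \<open>q > 0\<close>.\<close>
lemma basis_dominated_by:
  assumes "B x y \<le> -1"
  shows "dominated_by x (rfl x y)"
proof (rule form_ge_1_imp_dominated_by)
  show "x \<in> pos" by (rule basis_pos)
  show "rfl x y \<in> pos" using rfl_basis_pos basis_pos by blast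
  show "1 \<le> B x (rfl x y)" using assms basis_norm by (simp add: rfl_eq form_simps)
  fix p q :: real assume "0 < q"
  have "p *\<^sub>R x - q *\<^sub>R rfl x y = (p + 2 * q * B x y) *\<^sub>R x + (- q) *\<^sub>R y"
    by (simp add: rfl_eq algebra_simps)
  then show "p *\<^sub>R x - q *\<^sub>R rfl x y \<notin> pos" using basis_coords_nonneg(2)[of "p + 2 * q * B x y" "- q"] \<open>0 < q\<close> by auto
qed

text \<open>The vectors with successive Chebyshev coefficients \<open>sin ((k+1) t) / sin t\<close>, \<open>sin (k t) / sin t\<close> are roots, and
  the coefficients of a root of the plane do not have opposite signs. So the sequence passes through zero before it
  becomes negative, which makes \<open>t\<close> a fraction \<open>\<pi> / j\<close>.\<close>
lemma basis_angle:
  assumes "-1 < B x y"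
  shows "\<exists>m\<ge>2. B x y = - cos (pi / real m)"
proof -
  define c where "c = - B x y"
  have c: "0 \<le> c" "c < 1" using form_basis_nonpos assms by (auto simp: c_def)
  define t where "t = arccos c"
  have t: "0 < t" "t \<le> pi / 2" "cos t = c"
    using c arccos_lt_bounded[of c] arccos_le_pi2[of c] by (auto simp: t_def)
  then have st: "0 < sin t" by (intro sin_gt_zero) linarith+
  have r: "cheb c (Suc k) *\<^sub>R x + cheb c k *\<^sub>R y \<in> Phi \<and> cheb c k *\<^sub>R x + cheb c (Suc k) *\<^sub>R y \<in> Phi" for k
  proof (induction k)
    case 0 then show ?case using basis_Phi by simp
  next
    case (Suc k)
    have "rfl x (cheb c k *\<^sub>R x + cheb c (Suc k) *\<^sub>R y) \<in> Phi"
      "rfl y (cheb c (Suc k) *\<^sub>R x + cheb c k *\<^sub>R y) \<in> Phi"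
      using Suc rfl_Phi basis_Phi by blast+
    then show ?case
      unfolding rfl_fst_pair[OF basis_norm(1)] rfl_snd_pair[OF basis_norm(2)] c_def[symmetric] by simp
  qed
  define k where "k = (LEAST k. cheb c k < 0)"
  have k: "cheb c k < 0" unfolding k_def by (rule LeastI_ex[OF cheb_negative[OF c(2)]])
  then obtain j where j: "k = Suc j" by (cases k) auto
  have nonneg: "0 \<le> cheb c i" if "i < k" for i
    using not_less_Least[of i "\<lambda>k. cheb c k < 0"] that by (simp add: k_def)
  \<comment> \<open>otherwise the coefficients of a root in \<open>Phi\<close> have opposite signs\<close>
  have "cheb c j \<le> 0"
  proof (rule ccontr)
    assume "\<not> ?thesis"
    then have "cheb c k *\<^sub>R x + cheb c j *\<^sub>R y \<in> pos" using r[of j] basis_pos_of_snd_pos j by simp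
    then show False using basis_coords_nonneg(1) k by fastforce
  qed
  then have "cheb c j = 0" using nonneg[of j] j by simp
  then have "sin (real j * t) = 0" using sin_mult_cheb_cos[of t j] t by simp
  have "1 < k" using k by (cases "k = 0"; cases "k = 1") auto
  have "0 \<le> sin (real i * t)" if "i < k" for i
    using sin_mult_cheb_cos[of t i] nonneg[OF that] st t by (metis mult_nonneg_nonneg less_imp_le)
  have small: "real i * t \<le> pi" if "i < k" for i
    using that
  proof (induction i)
    case (Suc i)
    show ?case
    proof (rule ccontr)
      assume "\<not> ?thesis"
      moreover have "real (Suc i) * t \<le> pi + t" using Suc by (simp add: algebra_simps)
      ultimately have "sin (real (Suc i) * t) < 0" using t by (intro sin_lt_zero) linarith+
      then show False using \<open>\<And>i. i < k \<Longrightarrow> 0 \<le> sin (real i * t)\<close>[of "Suc i"] Suc.prems by linarith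
    qed
  qed simp
  have "0 < j" using j \<open>1 < k\<close> by simp
  have "real j * t = pi"
  proof (rule ccontr)
    assume "real j * t \<noteq> pi"
    then have "0 < sin (real j * t)" using small[of j] j t \<open>0 < j\<close> by (intro sin_gt_zero) auto
    then show False using \<open>sin (real j * t) = 0\<close> by simp
  qed
  then have tj: "t = pi / real j" using \<open>0 < j\<close> by (simp add: field_simps)
  have "j \<noteq> 1" using tj t by auto
  then have "2 \<le> j" using \<open>0 < j\<close> by simp
  then show ?thesis using t tj by (intro exI[of _ j]) (auto simp: c_def)
qed

end

section \<open>Descent in a plane\<close>

definition plane_inversions :: "'v set \<Rightarrow> 'v \<Rightarrow> 'v set" where
  "plane_inversions P z = {w \<in> P \<inter> pos. rfl z w \<in> neg}"

lemma finite_plane_inversions: "z \<in> pos \<Longrightarrow> finite (plane_inversions P z)"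
  using finite_inversions[OF rfl_G[OF pos_Phi]] by (rule finite_subset[rotated]) (auto simp: plane_inversions_def)

text \<open>The reflection \<open>s\<^sub>x\<close> permutes the positive roots of the plane other than \<open>x\<close>, and it maps the
  inversions of the reflection in \<open>s\<^sub>x z\<close> injectively to those of \<open>s\<^sub>z\<close>, without reaching the inversion \<open>x\<close>.\<close>
lemma plane_inversions_decrease:
  assumes xy: "dihedral_basis P x y" and z: "z \<in> P \<inter> pos" "z \<noteq> x" "z \<noteq> y" "0 < B x z"
  shows "card (plane_inversions P (rfl x z)) < card (plane_inversions P z)"
proof -
  note basis = basis_pos[OF xy]
  have xx: "B x x = 1" "x \<in> Phi" using basis_norm[OF xy] basis_Phi[OF xy] by auto
  let ?s = "rfl x" and ?z = "rfl x z"
  have ss: "?s (?s v) = v" for v using rfl_rfl xx by blast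
  have z': "?z \<in> pos" using rfl_basis_pos[OF xy] z by blast
  have zP: "z \<in> Phi" "B z z = 1" using z pos_Phi norm_Phi by auto
  have rz: "rfl ?z v = ?s (rfl z (?s v))" for v
    using isometry_rfl[OF linear_rfl, of x z "?s v"] form_rfl xx ss by simp
  have rzx: "rfl ?z x = x + (2 * B x z) *\<^sub>R ?z"
    by (simp add: rz rfl_self xx linear_neg[OF linear_rfl])
       (simp add: rfl_eq form_simps xx sym[of z x] algebra_simps scaleR_2)
  obtain p q where pq: "0 \<le> p" "0 \<le> q" "z = p *\<^sub>R x + q *\<^sub>R y"
    using basis_coords[OF xy] z by blast
  have "q \<noteq> 0" using pos_multiple[of z x p] pq z basis by auto
  have rx: "rfl z x = (1 - 2 * B x z * p) *\<^sub>R x + (- (2 * B x z * q)) *\<^sub>R y"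
    unfolding rfl_eq sym[of z x] by (subst (2) pq(3)) (simp add: algebra_simps)
  have rx_npos: "rfl z x \<notin> pos"
  proof
    assume "rfl z x \<in> pos"
    then have "0 \<le> - (2 * B x z * q)" unfolding rx by (rule basis_coords_nonneg(2)[OF xy])
    moreover have "0 < B x z * q" using z(4) \<open>q \<noteq> 0\<close> pq(2) by simp
    ultimately show False by linarith
  qed
  then have x_in: "x \<in> plane_inversions P z"
    using not_pos_iff rfl_Phi zP xx basis by (auto simp: plane_inversions_def)
  have "?s w \<in> plane_inversions P z - {x}" if w: "w \<in> plane_inversions P ?z" for w
  proof -
    have w': "w \<in> P" "w \<in> pos" "rfl ?z w \<in> neg" using w by (auto simp: plane_inversions_def)
    have "rfl ?z x \<in> pos"
    proof (rule pos_combination[OF _ basis(1) z'])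
      show "rfl ?z x \<in> Phi" using rfl_Phi pos_Phi z' xx by blast
      show "rfl ?z x = 1 *\<^sub>R x + (2 * B x z) *\<^sub>R ?z" unfolding rzx by simp
    qed (use z(4) in simp_all)
    then have "w \<noteq> x" using w' pos_not_neg by blast
    then have sw: "?s w \<in> pos" "?s w \<in> P" using rfl_basis_pos[OF xy] rfl_plane[OF xy] w' basis by auto
    have "?s w \<noteq> x"
    proof
      assume "?s w = x"
      then have "w = - x" using ss[of w] rfl_self xx by simp
      then show False using w' basis pos_not_neg[of w] by (simp add: neg_iff)
    qed
    have "rfl z (?s w) \<in> neg"
    proof (rule ccontr)
      assume "rfl z (?s w) \<notin> neg"
      then have g: "rfl z (?s w) \<in> pos" using not_pos_iff rfl_Phi zP sw pos_Phi by blast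
      have "rfl z (?s w) \<noteq> x"
      proof
        assume "rfl z (?s w) = x"
        then have "rfl z x = ?s w" using rfl_rfl[OF zP(2), of "?s w"] by simp
        then show False using rx_npos sw by simp
      qed
      then have "?s (rfl z (?s w)) \<in> pos"
        using rfl_basis_pos[OF xy] g rfl_plane[OF xy] sw z by blast
      then show False using w'(3) rz pos_not_neg by simp
    qed
    then show ?thesis using sw \<open>?s w \<noteq> x\<close> by (simp add: plane_inversions_def)
  qed
  then have "?s ` plane_inversions P ?z \<subseteq> plane_inversions P z - {x}" by (rule image_subsetI)
  moreover have "inj_on ?s (plane_inversions P ?z)" by (rule inj_on_inverseI) (rule ss)
  ultimately have "card (plane_inversions P ?z) \<le> card (plane_inversions P z - {x})"
    using finite_plane_inversions[of z P] z by (intro card_inj_on_le) auto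
  also have "\<dots> < card (plane_inversions P z)"
    using x_in finite_plane_inversions[of z P] z by (intro card_Diff1_less) auto
  finally show ?thesis .
qed

text \<open>From \<open>1 = B z z = p B x z + q B y z\<close> with \<open>p, q \<ge> 0\<close>, one of the products is positive, and reflecting in
  that simple root diminishes the number of inversions.\<close>
lemma plane_root_descent [consumes 2, case_names fst snd fst_step snd_step]:
  assumes xy: "dihedral_basis P x y" and z: "z \<in> P \<inter> pos"
    and "Q x" "Q y"
    and fst: "\<And>z. z \<in> P \<inter> pos \<Longrightarrow> z \<noteq> x \<Longrightarrow> 0 < B x z \<Longrightarrow> rfl x z \<in> P \<inter> pos \<Longrightarrow> Q (rfl x z) \<Longrightarrow> Q z"
    and snd: "\<And>z. z \<in> P \<inter> pos \<Longrightarrow> z \<noteq> y \<Longrightarrow> 0 < B y z \<Longrightarrow> rfl y z \<in> P \<inter> pos \<Longrightarrow> Q (rfl y z) \<Longrightarrow> Q z"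
  shows "Q z"
  using z
proof (induction "card (plane_inversions P z)" arbitrary: z rule: less_induct)
  case less
  note yx = dihedral_basis_sym[OF xy]
  show ?case
  proof (cases "z = x \<or> z = y")
    case False
    obtain p q where pq: "0 \<le> p" "0 \<le> q" "z = p *\<^sub>R x + q *\<^sub>R y"
      using basis_coords[OF xy] less.prems by blast
    have "p * B x z + q * B y z = 1"
    proof -
      have "1 = B z z" using less.prems norm_Phi pos_Phi by auto
      also have "\<dots> = p * B x z + q * B y z" by (subst (1) pq(3)) (simp add: form_simps)
      finally show ?thesis by simp
    qed
    then have "0 < B x z \<or> 0 < B y z" using pq
      by (metis add_nonpos_nonpos mult_nonneg_nonpos not_le not_one_le_zero zero_less_one_class.zero_le_one order_refl)
    moreover have "rfl x z \<in> P \<inter> pos" "rfl y z \<in> P \<inter> pos"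
      using rfl_basis_pos[OF xy] rfl_basis_pos[OF yx] rfl_plane[OF xy] basis_pos[OF xy] less.prems False by auto
    ultimately show ?thesis
      using less plane_inversions_decrease[OF xy, of z] plane_inversions_decrease[OF yx, of z] False fst snd
      by metis
  qed (use assms in blast)
qed

text \<open>On the descent the depth does not grow, because \<open>B x (s\<^sub>x z) = - B x z < 0\<close>. The last root before the
  descent reaches \<open>x\<close> or \<open>y\<close> is \<open>s\<^sub>x y\<close> or \<open>s\<^sub>y x\<close>.\<close>
lemma descent_small:
  assumes xy: "dihedral_basis P x y" and z: "z \<in> P \<inter> pos" "z \<noteq> x" "z \<noteq> y" and dz: "depth z \<le> n"
  shows "B x y < 0 \<and> (depth (rfl x y) \<le> n \<or> depth (rfl y x) \<le> n)"
proof -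
  let ?Q = "\<lambda>x y z. z \<noteq> x \<longrightarrow> z \<noteq> y \<longrightarrow> depth z \<le> n \<longrightarrow>
    B x y < 0 \<and> (depth (rfl x y) \<le> n \<or> depth (rfl y x) \<le> n)"
  have step: "?Q x y z"
    if xy: "dihedral_basis P x y" and z: "z \<in> P \<inter> pos" and b: "0 < B x z" and z': "rfl x z \<in> P \<inter> pos"
      and Q: "?Q x y (rfl x z)" for x y z
  proof (intro impI)
    assume zz: "z \<noteq> x" "z \<noteq> y" "depth z \<le> n"
    have xx: "B x x = 1" "x \<in> pos" using basis_norm[OF xy] basis_pos[OF xy] by auto
    have ss: "rfl x (rfl x z) = z" using rfl_rfl xx by blast
    have b': "B x (rfl x z) = - B x z" by (simp add: rfl_eq form_simps xx)
    have "depth (rfl x z) \<le> depth (rfl x (rfl x z))"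
      using depth_le_depth_rfl[of x "rfl x z"] z' xx b b' by simp
    then have d: "depth (rfl x z) \<le> n" using ss zz by simp
    have "rfl x z \<noteq> x"
    proof
      assume "rfl x z = x"
      then have "B x (rfl x z) = 1" using xx by simp
      then show False using b b' by simp
    qed
    show "B x y < 0 \<and> (depth (rfl x y) \<le> n \<or> depth (rfl y x) \<le> n)"
    proof (cases "rfl x z = y")
      case True
      then have "z = rfl x y" "B x y < 0" using b b' ss by auto
      then show ?thesis using zz by simp
    qed (use Q d \<open>rfl x z \<noteq> x\<close> in simp)
  qed
  have "?Q x y z"
    using xy z(1)
  proof (induction rule: plane_root_descent)
    case (fst_step z)
    then show ?case using step[OF xy] by blast
  next
    case (snd_step z)
    then show ?case using step[OF dihedral_basis_sym[OF xy], of z] sym[of x y] by auto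
  qed auto
  then show ?thesis using z dz by blast
qed

end

section \<open>Dihedral reflection subgroups\<close>

text \<open>With \<open>c = g h\<close> one has \<open>g c = c\<^sup>-\<^sup>1 g\<close>, so the elements \<open>c\<^sup>i\<close> and \<open>c\<^sup>i g\<close> form a group. Inverses
  are expressed as the power \<open>e = m - 1\<close> to stay within natural exponents.\<close>
lemma (in group) finite_generate_two_involutions:
  assumes g: "g \<in> carrier G" "g \<otimes> g = \<one>" and h: "h \<in> carrier G" "h \<otimes> h = \<one>"
    and m: "0 < (m::nat)" "(g \<otimes> h) [^] m = \<one>"
  shows "finite (generate G {g, h})"
proof -
  define c where "c = g \<otimes> h"
  have c: "c \<in> carrier G" using g h by (simp add: c_def)
  define e where "e = m - 1"
  let ?C = "range (\<lambda>i::nat. c [^] i) \<union> range (\<lambda>i::nat. c [^] i \<otimes> g)"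
  have "c [^] e \<otimes> c = \<one>"
    using m c nat_pow_Suc[of c e] by (simp add: e_def c_def del: nat_pow_Suc)
  then have ce: "c [^] e = inv c" using c by (metis inv_equality nat_pow_closed inv_inv)
  have "inv c = h \<otimes> g"
    using g h by (simp add: c_def inv_mult_group) (metis inv_equality)
  then have h_eq: "h = c [^] e \<otimes> g" using ce g h by (simp add: m_assoc)
  have gc: "g \<otimes> c = h" using g h by (simp add: c_def flip: m_assoc)
  have move: "g \<otimes> c [^] j = c [^] (e * j) \<otimes> g" for j :: nat
  proof (induction j)
    case (Suc j)
    have "g \<otimes> c [^] Suc j = c [^] (e * j) \<otimes> (g \<otimes> c)"
      using Suc c g by (simp add: m_assoc[symmetric])
    also have "\<dots> = c [^] (e * j) \<otimes> c [^] e \<otimes> g"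
      unfolding gc using h_eq c g by (metis m_assoc nat_pow_closed)
    also have "\<dots> = c [^] (e * Suc j) \<otimes> g" using c by (simp add: nat_pow_mult add.commute)
    finally show ?case .
  qed (use g in simp)
  have gC: "g \<in> ?C" using rangeI[of "\<lambda>i::nat. c [^] i \<otimes> g" 0] g by simp
  have hC: "h \<in> ?C" using rangeI[of "\<lambda>i::nat. c [^] i \<otimes> g" e] h_eq by simp
  have "x \<in> ?C" if "x \<in> generate G {g, h}" for x
    using that
  proof (induction rule: generate.induct)
    case one
    then show ?case using nat_pow_0[of c] by (metis UnI1 rangeI)
  next
    case (incl x)
    then show ?case using gC hC by blast
  next
    case (inv x)
    have "inv g = g" "inv h = h" using g h inv_equality by auto
    then have "inv x = x" using inv by auto
    then show ?case using inv gC hC by auto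
  next
    case (eng x y)
    have cc: "c [^] i \<otimes> c [^] j = c [^] (i + j)" for i j :: nat using c by (simp add: nat_pow_mult)
    have cg: "(c [^] i \<otimes> g) \<otimes> c [^] j = c [^] (i + e * j) \<otimes> g" for i j :: nat
      using move[of j] c g by (simp add: m_assoc) (simp add: m_assoc[symmetric] cc)
    have 1: "c [^] i \<otimes> (c [^] j \<otimes> g) = c [^] (i + j) \<otimes> g" for i j :: nat
      using c g by (simp add: m_assoc[symmetric] cc)
    have 2: "(c [^] i \<otimes> g) \<otimes> (c [^] j \<otimes> g) = c [^] (i + e * j)" for i j :: nat
    proof -
      have "(c [^] i \<otimes> g) \<otimes> (c [^] j \<otimes> g) = (c [^] i \<otimes> g) \<otimes> c [^] j \<otimes> g"
        using c g by (simp add: m_assoc)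
      also have "\<dots> = c [^] (i + e * j)" unfolding cg using c g by (simp add: m_assoc)
      finally show ?thesis .
    qed
    show ?case using eng.IH cc cg 1 2 by auto
  qed
  then have "generate G {g, h} \<subseteq> ?C" by blast
  moreover have "finite ?C"
  proof -
    have cm: "c [^] i = c [^] (i mod m)" for i :: nat
    proof -
      have "c [^] i = c [^] (m * (i div m) + i mod m)" by simp
      also have "\<dots> = (c [^] m) [^] (i div m) \<otimes> c [^] (i mod m)"
        using c by (simp only: nat_pow_mult[symmetric] nat_pow_pow nat_pow_closed)
      finally show ?thesis using m(2) c by (simp add: c_def)
    qed
    have "range (\<lambda>i::nat. f (c [^] i)) \<subseteq> (\<lambda>i. f (c [^] i)) ` {..<m}" for f :: "'a \<Rightarrow> 'a"
    proof (rule image_subsetI)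
      fix i :: nat
      show "f (c [^] i) \<in> (\<lambda>i. f (c [^] i)) ` {..<m}"
        using m(1) by (intro image_eqI[of _ _ "i mod m"] arg_cong[OF cm]) simp
    qed
    then have "finite (range (\<lambda>i::nat. f (c [^] i)))" for f :: "'a \<Rightarrow> 'a"
      using finite_subset by blast
    from this[of "\<lambda>x. x"] this[of "\<lambda>x. x \<otimes> g"] show ?thesis by simp
  qed
  ultimately show ?thesis using finite_subset by blast
qed

text \<open>If the reflection in a third root \<open>z = p x + q y\<close> had no inversion in the plane but \<open>z\<close>, it would keep \<open>x\<close>
  and \<open>y\<close> positive, hence \<open>B z x \<le> 0\<close> and \<open>B z y \<le> 0\<close>, which contradicts \<open>B z z = 1\<close>.\<close>
lemma (in root_basis) canonical_simples_plane:
  assumes xy: "dihedral_basis P x y"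
  shows "{z \<in> pos. plane_inversions P z = {z}} = {x, y}"
proof -
  have "plane_inversions P x = {x}" if "dihedral_basis P x y" for x y
    using rfl_basis_pos[OF that] basis_pos[OF that] rfl_self_neg pos_not_neg
    by (auto simp: plane_inversions_def)
  then have "{x, y} \<subseteq> {z \<in> pos. plane_inversions P z = {z}}"
    using xy dihedral_basis_sym[OF xy] basis_pos[OF xy] by auto
  moreover have "z \<in> {x, y}" if z: "z \<in> pos" "plane_inversions P z = {z}" for z
  proof (rule ccontr)
    assume zxy: "z \<notin> {x, y}"
    have zP: "z \<in> P" using z(2) by (auto simp: plane_inversions_def)
    have B_le: "B z x \<le> 0" if xy: "dihedral_basis P x y" and "z \<noteq> x" for x y
    proof -
      obtain p q where pq: "0 \<le> p" "0 \<le> q" "z = p *\<^sub>R x + q *\<^sub>R y"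
        using basis_coords[OF xy zP z(1)] by blast
      have "q \<noteq> 0" using pos_multiple[of z x p] pq z \<open>z \<noteq> x\<close> basis_pos[OF xy] by auto
      have "x \<notin> plane_inversions P z" using z(2) \<open>z \<noteq> x\<close> by auto
      then have "rfl z x \<in> pos"
        using basis_pos[OF xy] not_pos_iff rfl_Phi z(1) pos_Phi by (auto simp: plane_inversions_def)
      moreover have "rfl z x = (1 - 2 * B z x * p) *\<^sub>R x + (- (2 * B z x * q)) *\<^sub>R y"
        unfolding rfl_eq by (subst (2) pq(3)) (simp add: algebra_simps)
      ultimately have "0 \<le> - (2 * B z x * q)" using basis_coords_nonneg(2)[OF xy] by metis
      then show ?thesis using \<open>q \<noteq> 0\<close> pq(2) by (simp add: mult_le_0_iff)
    qed
    obtain p q where pq: "0 \<le> p" "0 \<le> q" "z = p *\<^sub>R x + q *\<^sub>R y"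
      using basis_coords[OF xy zP z(1)] by blast
    have "1 = B z z" using z norm_Phi pos_Phi by auto
    also have "\<dots> = p * B z x + q * B z y" by (subst (2) pq(3)) (simp add: form_simps)
    also have "\<dots> \<le> 0"
      using pq B_le[OF xy] B_le[OF dihedral_basis_sym[OF xy]] zxy
      by (simp add: add_nonpos_nonpos mult_nonneg_nonpos)
    finally show False by simp
  qed
  ultimately show ?thesis by blast
qed

locale geom_rep =
  fixes R :: "('g, 'v::real_vector) rep_data"
  assumes geo: "geometric_representation R"

sublocale geom_rep \<subseteq> root_basis "form R" "gens R" "simple_root R"
  using geo by unfold_locales (auto simp: geometric_representation_def)

sublocale geom_rep \<subseteq> W: group "grp R"
  using geo by (simp add: geometric_representation_def coxeter_system_def)

context geom_rep begin

abbreviation W_carrier where "W_carrier \<equiv> carrier (grp R)"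

lemma act_mult: "x \<in> W_carrier \<Longrightarrow> y \<in> W_carrier \<Longrightarrow> act R (x \<otimes>\<^bsub>grp R\<^esub> y) = act R x \<circ> act R y"
  and act_inj: "inj_on (act R) W_carrier"
  and act_bij: "x \<in> W_carrier \<Longrightarrow> bij (act R x)"
  using geo unfolding geometric_representation_def mon_def hom_def by (auto simp: form_group_def)

lemma act_one: "act R \<one>\<^bsub>grp R\<^esub> = id"
proof -
  let ?f = "act R \<one>\<^bsub>grp R\<^esub>"
  have "?f \<circ> ?f = ?f" using act_mult[of "\<one>\<^bsub>grp R\<^esub>" "\<one>\<^bsub>grp R\<^esub>"] by simp
  then have "?f (?f v) = ?f v" for v by (metis comp_apply)
  then show ?thesis using act_bij[of "\<one>\<^bsub>grp R\<^esub>"] by (auto simp: bij_def inj_def fun_eq_iff)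
qed

lemma act_gen: "s \<in> gens R \<Longrightarrow> act R s = rfl (simple_root R s)"
  and gens_carrier: "s \<in> gens R \<Longrightarrow> s \<in> W_carrier"
  and carrier_eq: "W_carrier = generate (grp R) (gens R)"
  using geo unfolding geometric_representation_def coxeter_system_def by auto

lemma act_image: "act R ` W_carrier = G"
proof
  have "act R w \<in> G" if "w \<in> generate (grp R) (gens R)" for w
    using that
  proof (induction rule: generate.induct)
    case one
    then show ?case by (simp only: act_one id_G)
  next
    case (inv s)
    have "s \<otimes>\<^bsub>grp R\<^esub> s = \<one>\<^bsub>grp R\<^esub>"
      using inv act_inj by (intro inj_onD[OF act_inj])
        (simp_all add: act_mult gens_carrier act_gen act_one rfl_involution norm1)
    then have "inv\<^bsub>grp R\<^esub> s = s" using W.inv_equality inv gens_carrier by blast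
    then show ?case using inv act_gen rfl_simple_G by simp
  next
    case (eng x y)
    then show ?case using act_mult comp_G by (metis carrier_eq)
  qed (simp add: act_gen rfl_simple_G)
  then show "act R ` W_carrier \<subseteq> G" by (auto simp: carrier_eq)
  have "f \<in> act R ` W_carrier" if "f \<in> G" for f
    using that
  proof (induction rule: G_word_induct)
    case id
    then show ?case using act_one by (metis W.one_closed image_eqI)
  next
    case (rfl s f)
    then obtain w where "w \<in> W_carrier" "f = act R w" by blast
    then have "rfl (simple_root R s) \<circ> f = act R (s \<otimes>\<^bsub>grp R\<^esub> w)"
      using rfl by (simp add: act_mult gens_carrier act_gen)
    then show ?case using rfl \<open>w \<in> W_carrier\<close> gens_carrier by blast
  qed
  then show "G \<subseteq> act R ` W_carrier" by blast
qed

lemma roots_eq: "roots R = Phi"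
  unfolding roots_def Phi_def act_image[symmetric] by blast

lemma pos_roots_eq: "pos_roots R = pos"
  by (simp add: pos_roots_def pos_def roots_eq)

lemma neg_roots_eq: "neg_roots R = neg"
  by (simp add: neg_roots_def neg_def pos_roots_eq)

lemma inversions_iff:
  assumes "w \<in> W_carrier"
  shows "x \<in> inversions R w \<longleftrightarrow> x \<in> pos \<and> fun_inv (act R w) x \<in> neg"
proof -
  have "act R w \<in> G" using assms act_image by blast
  note inv = inv_G_simps[OF this]
  have "x \<in> act R w ` neg \<longleftrightarrow> fun_inv (act R w) x \<in> neg"
  proof
    assume "fun_inv (act R w) x \<in> neg"
    then show "x \<in> act R w ` neg" by (intro rev_image_eqI[of "fun_inv (act R w) x"]) (simp_all add: inv)
  qed (auto simp: inv)
  then show ?thesis by (simp add: inversions_def pos_roots_eq neg_roots_eq)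
qed

lemma dominated_iff:
  assumes "x \<in> pos" "y \<in> pos"
  shows "dominated R x y \<longleftrightarrow> dominated_by x y"
proof -
  have "fun_inv ` G = G"
  proof
    show "G \<subseteq> fun_inv ` G"
    proof
      fix f assume "f \<in> G"
      then show "f \<in> fun_inv ` G" using inv_G inv_inv_eq[OF bij_G] by (metis imageI)
    qed
  qed (use inv_G in blast)
  then have "dominated_by x y \<longleftrightarrow> (\<forall>f\<in>fun_inv ` G. f y \<in> neg \<longrightarrow> f x \<in> neg)"
    by (simp only: dominated_by_def)
  then show ?thesis
    using assms by (simp add: dominated_def inversions_iff flip: act_image)
qed

lemma small_roots_iff: "x \<in> small_roots R n \<longleftrightarrow> x \<in> pos \<and> depth x \<le> n"
proof -
  have "inf_depth R x = depth x" if "x \<in> pos"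
    unfolding inf_depth_def depth_def pos_roots_eq using dominated_iff that by (metis (no_types, lifting))
  then show ?thesis by (auto simp: small_roots_def pos_roots_eq)
qed

lemma refl_elt:
  assumes "x \<in> Phi"
  shows "refl_elt R x \<in> W_carrier" "act R (refl_elt R x) = rfl x"
proof -
  have "rfl x \<in> act R ` W_carrier" using rfl_G assms act_image by simp
  then show "refl_elt R x \<in> W_carrier" "act R (refl_elt R x) = rfl x"
    unfolding refl_elt_def by (rule inv_into_into, rule f_inv_into_f)
qed

lemma refl_elt_involution:
  assumes "x \<in> Phi"
  shows "refl_elt R x \<otimes>\<^bsub>grp R\<^esub> refl_elt R x = \<one>\<^bsub>grp R\<^esub>"
  using assms by (intro inj_onD[OF act_inj])
    (simp_all add: act_mult refl_elt act_one rfl_involution norm_Phi)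

lemma refl_elt_rfl:
  assumes "x \<in> Phi" "y \<in> Phi"
  shows "refl_elt R (rfl x y) = refl_elt R x \<otimes>\<^bsub>grp R\<^esub> refl_elt R y \<otimes>\<^bsub>grp R\<^esub> refl_elt R x"
proof (rule inj_onD[OF act_inj])
  have "rfl (rfl x y) v = rfl x (rfl y (rfl x v))" for v
    using isometry_rfl[OF linear_rfl, of x y "rfl x v"] norm_Phi assms by (simp add: form_rfl rfl_rfl)
  then show "act R (refl_elt R (rfl x y))
    = act R (refl_elt R x \<otimes>\<^bsub>grp R\<^esub> refl_elt R y \<otimes>\<^bsub>grp R\<^esub> refl_elt R x)"
    using assms by (simp add: act_mult refl_elt rfl_Phi fun_eq_iff)
qed (use assms refl_elt rfl_Phi in auto)

lemma refl_elt_uminus: "refl_elt R (- x) = refl_elt R x"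
  by (simp add: refl_elt_def rfl_uminus)

lemma inversions_refl_elt:
  assumes "z \<in> Phi"
  shows "x \<in> inversions R (refl_elt R z) \<longleftrightarrow> x \<in> pos \<and> rfl z x \<in> neg"
proof -
  have "fun_inv (rfl z) = rfl z"
    using inv_unique_comp[OF rfl_involution rfl_involution] norm_Phi assms by blast
  then show ?thesis using inversions_iff refl_elt assms by simp
qed

definition plane_group :: "'v set \<Rightarrow> 'g set" where
  "plane_group P = generate (grp R) (refl_elt R ` (P \<inter> Phi))"

lemma maximal_dihedral_iff:
  "maximal_dihedral R W' \<longleftrightarrow> (\<exists>P. subspace P \<and> dim P = 2 \<and>
     (\<exists>x\<in>P \<inter> pos. \<exists>y\<in>P \<inter> pos. x \<noteq> y) \<and> W' = plane_group P)"
  unfolding maximal_dihedral_def plane_group_def pos_roots_eq roots_eq ..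

text \<open>The group moves every vector only by elements of \<open>P\<close>, and the reflection in \<open>\<beta>\<close> moves \<open>\<beta>\<close> by
  \<open>- 2 \<beta>\<close>.\<close>
lemma sub_roots_plane_group:
  assumes P: "subspace P"
  shows "sub_roots R (plane_group P) = P \<inter> Phi"
proof
  show "P \<inter> Phi \<subseteq> sub_roots R (plane_group P)"
    unfolding sub_roots_def plane_group_def roots_eq by (auto intro: generate.incl)
  have gen: "w \<in> W_carrier \<and> (\<forall>v. act R w v - v \<in> P)" if "w \<in> plane_group P" for w
    using that unfolding plane_group_def
  proof (induction rule: generate.induct)
    case one
    then show ?case using P by (simp add: act_one subspace_0)
  next
    case (incl w)
    then show ?case using P refl_elt by (auto simp: rfl_eq subspace_neg subspace_scale)
  next
    case (inv w)
    then obtain x where x: "x \<in> P \<inter> Phi" "w = refl_elt R x" by blast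
    then have "inv\<^bsub>grp R\<^esub> w = w" using W.inv_equality refl_elt_involution refl_elt by blast
    then show ?case using P refl_elt x by (auto simp: rfl_eq subspace_neg subspace_scale)
  next
    case (eng w w')
    have "act R (w \<otimes>\<^bsub>grp R\<^esub> w') v - v = (act R w (act R w' v) - act R w' v) + (act R w' v - v)" for v
      using eng by (simp add: act_mult)
    then show ?case using eng.IH P by (metis W.m_closed subspace_add)
  qed
  show "sub_roots R (plane_group P) \<subseteq> P \<inter> Phi"
  proof
    fix x assume "x \<in> sub_roots R (plane_group P)"
    then have x: "x \<in> Phi" "refl_elt R x \<in> plane_group P" by (auto simp: sub_roots_def roots_eq)
    then have "rfl x x - x \<in> P" using gen refl_elt by metis
    then have "(- 1 / 2) *\<^sub>R (rfl x x - x) \<in> P" using P subspace_scale by blast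
    moreover have "(- 1 / 2) *\<^sub>R (rfl x x - x) = x"
      using norm_Phi x by (simp add: rfl_self scaleR_right_diff_distrib flip: scaleR_left_distrib)
    ultimately show "x \<in> P \<inter> Phi" using x by simp
  qed
qed

lemma canonical_simples_plane_group:
  assumes xy: "dihedral_basis P x y"
  shows "canonical_simples R (plane_group P) = {x, y}"
proof -
  have "inversions R (refl_elt R z) \<inter> sub_roots R (plane_group P) = plane_inversions P z" if "z \<in> pos" for z
    unfolding sub_roots_plane_group[OF basis_pos(6)[OF xy]]
    using inversions_refl_elt[OF pos_Phi[OF that]] pos_Phi by (auto simp: plane_inversions_def)
  then have "canonical_simples R (plane_group P) = {z \<in> pos. plane_inversions P z = {z}}"
    unfolding canonical_simples_def pos_roots_eq by (metis (no_types, lifting))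
  then show ?thesis using canonical_simples_plane[OF xy] by simp
qed

text \<open>By descent, every reflection in a root of the plane is conjugate to one of the two simple
  ones within the group that they generate.\<close>
lemma plane_group_eq:
  assumes xy: "dihedral_basis P x y"
  shows "plane_group P = generate (grp R) {refl_elt R x, refl_elt R y}"
proof
  let ?H = "generate (grp R) {refl_elt R x, refl_elt R y}"
  note xP = basis_Phi[OF xy]
  show "?H \<subseteq> plane_group P"
    unfolding plane_group_def using basis_pos[OF xy] xP by (intro W.mono_generate) auto
  have sub: "subgroup ?H (grp R)" using refl_elt xP by (intro W.generate_is_subgroup) auto
  have x: "refl_elt R x \<in> ?H" and y: "refl_elt R y \<in> ?H" by (auto intro: generate.incl)
  have conj: "refl_elt R z \<in> ?H" if "w \<in> {x, y}" "z \<in> pos" "refl_elt R (rfl w z) \<in> ?H" for w z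
  proof -
    have w: "w \<in> Phi" using that xP by auto
    have "z = rfl w (rfl w z)" using rfl_rfl norm_Phi w by simp
    then have "refl_elt R z = refl_elt R w \<otimes>\<^bsub>grp R\<^esub> refl_elt R (rfl w z) \<otimes>\<^bsub>grp R\<^esub> refl_elt R w"
      using refl_elt_rfl[OF w rfl_Phi[OF w pos_Phi[OF that(2)]]] by simp
    then show ?thesis using that x y sub by (auto intro!: subgroup.m_closed)
  qed
  have p: "refl_elt R z \<in> ?H" if "z \<in> P \<inter> pos" for z
    using xy that
    by (induction rule: plane_root_descent) (use x y conj in auto)
  have "refl_elt R z \<in> ?H" if "z \<in> P \<inter> Phi" for z
  proof (cases "z \<in> pos")
    case False
    then have "- z \<in> P \<inter> pos" using that not_pos_iff basis_pos[OF xy] by (auto simp: neg_iff subspace_neg)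
    then show ?thesis using p[of "- z"] by (simp add: refl_elt_uminus)
  qed (use p that in blast)
  then show "plane_group P \<subseteq> ?H"
    unfolding plane_group_def using sub by (intro W.generate_subgroup_incl) auto
qed

lemma finite_plane_group:
  assumes xy: "dihedral_basis P x y" and b: "-1 < form R x y"
  shows "finite (plane_group P)"
proof -
  obtain m where m: "2 \<le> m" "form R x y = - cos (pi / real m)" using basis_angle[OF xy b] by blast
  note xP = basis_Phi[OF xy] and xx = basis_norm[OF xy]
  let ?x = "refl_elt R x" and ?y = "refl_elt R y"
  have c: "?x \<in> W_carrier" "?y \<in> W_carrier" using refl_elt xP by auto
  have "act R ((?x \<otimes>\<^bsub>grp R\<^esub> ?y) [^]\<^bsub>grp R\<^esub> k) = (rfl x \<circ> rfl y) ^^ k" for k :: nat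
    by (induction k) (simp_all add: act_one act_mult c refl_elt xP funpow_Suc_right del: funpow.simps(2))
  then have "(?x \<otimes>\<^bsub>grp R\<^esub> ?y) [^]\<^bsub>grp R\<^esub> m = \<one>\<^bsub>grp R\<^esub>"
    using rotation_order[OF xx m(2,1)] c by (intro inj_onD[OF act_inj]) (simp_all add: act_one)
  then show ?thesis
    unfolding plane_group_eq[OF xy] using c refl_elt_involution xP m(1)
    by (intro W.finite_generate_two_involutions[where m = m]) auto
qed

end

section \<open>Bipodality of the small roots\<close>

theorem corollary5p6:
  fixes R :: "('g, 'v::real_vector) rep_data" and n :: nat
  assumes "geometric_representation R"
  shows "bipodal R (small_roots R n) \<longleftrightarrow>
    (\<forall>\<alpha>\<in>pos_roots R. \<forall>\<beta>\<in>pos_roots R.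
       let W' = generate (grp R) {refl_elt R \<alpha>, refl_elt R \<beta>} in
         finite W' \<and> maximal_dihedral R W' \<and> canonical_simples R W' = {\<alpha>, \<beta>} \<and>
         form R \<alpha> \<beta> \<noteq> 0 \<and> reflection (form R) \<alpha> \<beta> \<in> small_roots R n \<longrightarrow>
         \<alpha> \<in> small_roots R n)"
    (is "_ \<longleftrightarrow> ?finite_case")
proof
  interpret geom_rep R by unfold_locales (rule assms)
  assume bip: "bipodal R (small_roots R n)"
  show ?finite_case
    unfolding Let_def
  proof (intro ballI impI, elim conjE)
    fix x y
    assume "x \<in> pos_roots R" "y \<in> pos_roots R"
    then have x: "x \<in> pos" "x \<in> Phi" and y: "y \<in> pos" "y \<in> Phi" by (simp_all add: pos_roots_eq pos_Phi)
    let ?W = "generate (grp R) {refl_elt R x, refl_elt R y}"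
    assume max: "maximal_dihedral R ?W" and can: "canonical_simples R ?W = {x, y}"
      and nz: "form R x y \<noteq> 0" and small: "rfl x y \<in> small_roots R n"
    have "refl_elt R (rfl x y) \<in> ?W"
      unfolding refl_elt_rfl[OF x(2) y(2)] by (intro generate.eng) (auto intro: generate.incl)
    then have "rfl x y \<in> sub_pos_roots R ?W"
      using small rfl_Phi x y by (simp add: sub_pos_roots_def sub_roots_def roots_eq pos_roots_eq small_roots_iff)
    moreover have "rfl x y \<noteq> y" using nz nonzero_Phi x by (simp add: rfl_eq)
    moreover have "rfl x y \<noteq> x"
    proof
      assume "rfl x y = x"
      then have "y = - x" using rfl_rfl[of x y] rfl_self norm_Phi x by metis
      then show False using x y pos_not_neg[of x] by (simp add: neg_iff)
    qed
    ultimately have "small_roots R n \<inter> (sub_pos_roots R ?W - canonical_simples R ?W) \<noteq> {}"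
      using small can by blast
    then show "x \<in> small_roots R n" using bip max can unfolding bipodal_def by blast
  qed
next
  interpret geom_rep R by unfold_locales (rule assms)
  assume finite_case: ?finite_case
  \<comment> \<open>the two simple roots are small as soon as their nearest neighbour \<open>s\<^sub>x y\<close> on the side of \<open>x\<close> is\<close>
  have corner: "x \<in> small_roots R n \<and> y \<in> small_roots R n"
    if P: "dim P = 2" and xy: "dihedral_basis P x y" and neg: "form R x y < 0"
      and d: "depth (rfl x y) \<le> n" for P x y
  proof
    note basis = basis_pos[OF xy]
    have r: "rfl x y \<in> pos" using rfl_basis_pos[OF xy] basis by blast
    show "y \<in> small_roots R n"
      using depth_le_depth_rfl[of x y] basis neg d by (simp add: small_roots_iff)
    show "x \<in> small_roots R n"
    proof (cases "form R x y \<le> -1")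
      case True
      then show ?thesis
        using depth_mono[OF basis(1) r basis_dominated_by[OF xy True]] d basis by (simp add: small_roots_iff)
    next
      case False
      have "finite (plane_group P)" using finite_plane_group[OF xy] False by simp
      moreover have "maximal_dihedral R (plane_group P)"
        unfolding maximal_dihedral_iff using P basis by blast
      ultimately show ?thesis
        using finite_case[unfolded Let_def, rule_format, of x y] canonical_simples_plane_group[OF xy]
          neg r d basis unfolding plane_group_eq[OF xy] by (simp add: pos_roots_eq small_roots_iff)
    qed
  qed
  show "bipodal R (small_roots R n)"
    unfolding bipodal_def
  proof (intro conjI allI impI)
    show "small_roots R n \<subseteq> pos_roots R" by (auto simp: small_roots_def)
    fix W'
    assume "maximal_dihedral R W'"
      and ne: "small_roots R n \<inter> (sub_pos_roots R W' - canonical_simples R W') \<noteq> {}"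
    then obtain P where P: "subspace P" "dim P = 2" "\<exists>x\<in>P \<inter> pos. \<exists>y\<in>P \<inter> pos. x \<noteq> y"
        and W': "W' = plane_group P"
      by (auto simp: maximal_dihedral_iff)
    then obtain x y where xy: "dihedral_basis P x y" using dihedral_basis_exists by blast
    have can: "canonical_simples R W' = {x, y}" using canonical_simples_plane_group[OF xy] W' by simp
    obtain z where "z \<in> small_roots R n" "z \<in> sub_roots R W'" "z \<notin> canonical_simples R W'"
      using ne unfolding sub_pos_roots_def by blast
    then have z: "z \<in> P \<inter> pos" "z \<noteq> x" "z \<noteq> y" "depth z \<le> n"
      unfolding can unfolding W' sub_roots_plane_group[OF P(1)] by (simp_all add: small_roots_iff)
    then have "form R x y < 0" "depth (rfl x y) \<le> n \<or> depth (rfl y x) \<le> n"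
      using descent_small[OF xy] by blast+
    then show "canonical_simples R W' \<subseteq> small_roots R n"
      unfolding can using corner[OF P(2) xy] corner[OF P(2) dihedral_basis_sym[OF xy]] sym[of x y] by auto
  qed
qed

end
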